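(* Let $(!,\delta,\varepsilon,\Delta,\mathsf{e},\mathsf{m},\mathsf{m}_I,\nabla,\mathsf{u},\mathsf{S})$ be a monoidal Hopf coalgebra modality with a pre-codereliction $\eta$ on a symmetric monoidal category $\mathbb{X}$. Then for the additive enrichment on $\mathbb{X}$ defined by $$f+g:=\eta_A;\Delta_A;(!(f)\otimes!(g));\nabla_B;\varepsilon_B,\qquad 0:=\eta_A;\mathsf{e}_A;\mathsf{u}_B;\varepsilon_B\qquad(f,g:A\to B),$$ $\mathbb{X}$ is an additive symmetric monoidal category with negatives, where for a map $f:A\to B$, the map $-f:A\to B$ is equal to the composite $$-f=\eta_A;\mathsf{S}_A;!(f);\varepsilon_B.$$
   Context: Conventions: composition is written diagrammatically, $f;g$ means first $f$ then $g$. Symmetric monoidal categories are taken to be strict, with product $\otimes$, unit $I$, symmetry $\sigma_{A,B}:A\otimes B\to B\otimes A$. Additive category: each homset is a commutative monoid $(+,0)$ with $f;(g+h)=f;g+f;h$, $f;0=0$, $(g+h);k=g;k+h;k$, $0;k=0$. Additive symmetric monoidal category: a symmetric monoidal category that is additive and satisfies $f\otimes(g+h)=f\otimes g+f\otimes h$, $f\otimes 0=0$, $(g+h)\otimes k=g\otimes k+h\otimes k$, $0\otimes k=0$. It has negatives if each homset is an abelian group, i.e. every $f:A\to B$ has $-f:A\to B$ with $f+(-f)=0$. Coalgebra modality $(!,\delta,\varepsilon,\Delta,\mathsf{e})$: a comonad $(!,\delta,\varepsilon)$, with $\delta_A:!(A)\to!!(A)$, $\varepsilon_A:!(A)\to A$,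 together with natural transformations $\Delta_A:!(A)\to!(A)\otimes!(A)$, $\mathsf{e}_A:!(A)\to I$ such that each $(!(A),\Delta_A,\mathsf{e}_A)$ is a cocommutative comonoid and $\delta_A$ is a comonoid morphism: $\delta_A;\Delta_{!(A)}=\Delta_A;(\delta_A\otimes\delta_A)$, $\delta_A;\mathsf{e}_{!(A)}=\mathsf{e}_A$. Monoidal coalgebra modality $(!,\delta,\varepsilon,\Delta,\mathsf{e},\mathsf{m},\mathsf{m}_I)$: a coalgebra modality with a natural transformation $\mathsf{m}_{A,B}:!(A)\otimes!(B)\to!(A\otimes B)$ and a map $\mathsf{m}_I:I\to!(I)$ making $!$ a symmetric (lax) monoidal endofunctor, such that - $\mathsf{m}_{A,B};\delta_{A\otimes B}=(\delta_A\otimes\delta_B);\mathsf{m}_{!(A),!(B)};!(\mathsf{m}_{A,B})$, $\mathsf{m}_I;\delta_I=\mathsf{m}_I;!(\mathsf{m}_I)$, $\mathsf{m}_{A,B};\varepsilon_{A\otimes B}=\varepsilon_A\otimes\varepsilon_B$, $\mathsf{m}_I;\varepsilon_I=1_I$; - $\mathsf{m}_{A,B};\Delta_{A\otimes B}=(\Delta_A\otimes\Delta_B);(1\otimes\sigma_{!(A),!(B)}\otimes1);(\mathsf{m}_{A,B}\otimes\mathsf{m}_{A,B})$, $\mathsf{m}_{A,B};\mathsf{e}_{A\otimes B}=\mathsf{e}_A\otimes\mathsf{e}_B$, $\mathsf{m}_I;\Delta_I=\mathsf{m}_I\otimes\mathsf{m}_I$, $\mathsf{m}_I;\mathsf{e}_I=1_I$;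 - $\delta_A;!(\Delta_A)=\Delta_A;(\delta_A\otimes\delta_A);\mathsf{m}_{!(A),!(A)}$, $\delta_A;!(\mathsf{e}_A)=\mathsf{e}_A;\mathsf{m}_I$. Bialgebra modality $(!,\delta,\varepsilon,\Delta,\mathsf{e},\nabla,\mathsf{u})$: a coalgebra modality with natural transformations $\nabla_A:!(A)\otimes!(A)\to!(A)$, $\mathsf{u}_A:I\to!(A)$ such that each $(!(A),\nabla_A,\mathsf{u}_A)$ is a commutative monoid and $(!(A),\nabla_A,\mathsf{u}_A,\Delta_A,\mathsf{e}_A)$ is a bimonoid. Monoidal bialgebra modality $(!,\delta,\varepsilon,\Delta,\mathsf{e},\mathsf{m},\mathsf{m}_I,\nabla,\mathsf{u})$: both a monoidal coalgebra modality and a bialgebra modality (on the same coalgebra modality) such that - $(1_{!(A)}\otimes\nabla_B);\mathsf{m}_{A,B}=(\Delta_A\otimes1\otimes1);(1\otimes\sigma_{!(A),!(B)}\otimes1);(\mathsf{m}_{A,B}\otimes\mathsf{m}_{A,B});\nabla_{A\otimes B}$; - $(\nabla_A\otimes1_{!(B)});\mathsf{m}_{A,B}=(1\otimes1\otimes\Delta_B);(1\otimes\sigma_{!(A),!(B)}\otimes1);(\mathsf{m}_{A,B}\otimes\mathsf{m}_{A,B});\nabla_{A\otimes B}$; - $(\mathsf{u}_A\otimes1_{!(B)});\mathsf{m}_{A,B}=\mathsf{e}_B;\mathsf{u}_{A\otimes B}$, $(1_{!(A)}\otimes\mathsf{u}_B);\mathsf{m}_{A,B}=\mathsf{e}_A;\mathsf{u}_{A\otimes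 B}$; - $\nabla_A;\delta_A=(\delta_A\otimes\delta_A);\mathsf{m}_{!(A),!(A)};!(\nabla_A)$, $\mathsf{u}_A;\delta_A=\mathsf{m}_I;!(\mathsf{u}_A)$. Hopf coalgebra modality: a bialgebra modality with a natural transformation $\mathsf{S}_A:!(A)\to!(A)$ (antipode) such that $\Delta_A;(1\otimes\mathsf{S}_A);\nabla_A=\mathsf{e}_A;\mathsf{u}_A=\Delta_A;(\mathsf{S}_A\otimes1);\nabla_A$. Monoidal Hopf coalgebra modality: a monoidal bialgebra modality with $\mathsf{S}$ making it a Hopf coalgebra modality, such that $\mathsf{S}_A;\delta_A=\delta_A;!(\mathsf{S}_A)$ and $(1_{!(A)}\otimes\mathsf{S}_B);\mathsf{m}_{A,B}=\mathsf{m}_{A,B};\mathsf{S}_{A\otimes B}=(\mathsf{S}_A\otimes1_{!(B)});\mathsf{m}_{A,B}$. Pre-codereliction (for the underlying monoidal coalgebra modality): a natural transformation $\eta_A:A\to!(A)$ such that $\eta_A;\varepsilon_A=1_A$, $(\eta_A\otimes1_{!(B)});\mathsf{m}_{A,B}=(1_A\otimes\varepsilon_B);\eta_{A\otimes B}$, and $(1_{!(A)}\otimes\eta_B);\mathsf{m}_{A,B}=(\varepsilon_A\otimes1_B);\eta_{A\otimes B}$. *)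

theory Defs
  imports "HOL-Algebra.Group"
begin

text \<open>
  Categories are given by a carrier of objects, a carrier of arrows, and domain and codomain
  maps; all operations are unconstrained off these carriers. Composition is diagrammatic:
  \<open>f \<Zsemi> g\<close> is first \<open>f\<close>, then \<open>g\<close>.
\<close>

record ('o, 'a) category =
  Obj :: "'o set"
  Arr :: "'a set"
  Dom :: "'a \<Rightarrow> 'o"
  Cod :: "'a \<Rightarrow> 'o"
  Comp :: "'a \<Rightarrow> 'a \<Rightarrow> 'a"  (infixl \<open>\<Zsemi>\<index>\<close> 55)
  Ident :: "'o \<Rightarrow> 'a"  (\<open>\<iota>\<index>\<close>)

definition Hom :: "('o, 'a, 'x) category_scheme \<Rightarrow> 'o \<Rightarrow> 'o \<Rightarrow> 'a set" where
  "Hom C A B = {f \<in> Arr C. Dom C f = A \<and> Cod C f = B}"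

locale category =
  fixes C :: "('o, 'a, 'x) category_scheme" (structure)
  assumes Dom_Obj: "f \<in> Arr C \<Longrightarrow> Dom C f \<in> Obj C"
    and Cod_Obj: "f \<in> Arr C \<Longrightarrow> Cod C f \<in> Obj C"
    and Ident_Hom: "A \<in> Obj C \<Longrightarrow> \<iota> A \<in> Hom C A A"
    and Comp_Hom: "\<lbrakk>f \<in> Hom C A B; g \<in> Hom C B D\<rbrakk> \<Longrightarrow> f \<Zsemi> g \<in> Hom C A D"
    and Ident_left: "f \<in> Hom C A B \<Longrightarrow> \<iota> A \<Zsemi> f = f"
    and Ident_right: "f \<in> Hom C A B \<Longrightarrow> f \<Zsemi> \<iota> B = f"
    and Comp_assoc:
      "\<lbrakk>f \<in> Hom C A B; g \<in> Hom C B D; h \<in> Hom C D E\<rbrakk> \<Longrightarrow> (f \<Zsemi> g) \<Zsemi> h = f \<Zsemi> (g \<Zsemi> h)"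

record ('o, 'a) smc = "('o, 'a) category" +
  Ten :: "'o \<Rightarrow> 'o \<Rightarrow> 'o"  (infixr \<open>\<odot>\<index>\<close> 70)
  TenA :: "'a \<Rightarrow> 'a \<Rightarrow> 'a"  (infixr \<open>\<boxtimes>\<index>\<close> 70)
  Unit :: "'o"  (\<open>\<I>\<index>\<close>)
  Sym :: "'o \<Rightarrow> 'o \<Rightarrow> 'a"  (\<open>\<sigma>\<index>\<close>)

text \<open>The tensor is \<open>\<odot>\<close> on objects and \<open>\<boxtimes>\<close> on arrows.\<close>

locale strict_symmetric_monoidal_category = category C
  for C :: "('o, 'a, 'x) smc_scheme" (structure) +
  assumes Unit_Obj: "\<I> \<in> Obj C"
    and Ten_Obj: "\<lbrakk>A \<in> Obj C; B \<in> Obj C\<rbrakk> \<Longrightarrow> A \<odot> B \<in> Obj C"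
    and Ten_assoc: "\<lbrakk>A \<in> Obj C; B \<in> Obj C; D \<in> Obj C\<rbrakk> \<Longrightarrow> (A \<odot> B) \<odot> D = A \<odot> (B \<odot> D)"
    and Ten_unit_left: "A \<in> Obj C \<Longrightarrow> \<I> \<odot> A = A"
    and Ten_unit_right: "A \<in> Obj C \<Longrightarrow> A \<odot> \<I> = A"
    and TenA_Hom:
      "\<lbrakk>f \<in> Hom C A B; g \<in> Hom C A' B'\<rbrakk> \<Longrightarrow> f \<boxtimes> g \<in> Hom C (A \<odot> A') (B \<odot> B')"
    and TenA_Ident: "\<lbrakk>A \<in> Obj C; B \<in> Obj C\<rbrakk> \<Longrightarrow> \<iota> A \<boxtimes> \<iota> B = \<iota> (A \<odot> B)"
    and TenA_Comp:
      "\<lbrakk>f \<in> Hom C A B; g \<in> Hom C B D; f' \<in> Hom C A' B'; g' \<in> Hom C B' D'\<rbrakk>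
        \<Longrightarrow> (f \<Zsemi> g) \<boxtimes> (f' \<Zsemi> g') = (f \<boxtimes> f') \<Zsemi> (g \<boxtimes> g')"
    and TenA_assoc:
      "\<lbrakk>f \<in> Arr C; g \<in> Arr C; h \<in> Arr C\<rbrakk> \<Longrightarrow> (f \<boxtimes> g) \<boxtimes> h = f \<boxtimes> (g \<boxtimes> h)"
    and TenA_unit_left: "f \<in> Arr C \<Longrightarrow> \<iota> \<I> \<boxtimes> f = f"
    and TenA_unit_right: "f \<in> Arr C \<Longrightarrow> f \<boxtimes> \<iota> \<I> = f"
    and Sym_Hom: "\<lbrakk>A \<in> Obj C; B \<in> Obj C\<rbrakk> \<Longrightarrow> \<sigma> A B \<in> Hom C (A \<odot> B) (B \<odot> A)"
    and Sym_natural: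
      "\<lbrakk>f \<in> Hom C A B; g \<in> Hom C A' B'\<rbrakk> \<Longrightarrow> (f \<boxtimes> g) \<Zsemi> \<sigma> B B' = \<sigma> A A' \<Zsemi> (g \<boxtimes> f)"
    and Sym_inverse: "\<lbrakk>A \<in> Obj C; B \<in> Obj C\<rbrakk> \<Longrightarrow> \<sigma> A B \<Zsemi> \<sigma> B A = \<iota> (A \<odot> B)"
    and Sym_hexagon: "\<lbrakk>A \<in> Obj C; B \<in> Obj C; D \<in> Obj C\<rbrakk>
        \<Longrightarrow> \<sigma> A (B \<odot> D) = (\<sigma> A B \<boxtimes> \<iota> D) \<Zsemi> (\<iota> B \<boxtimes> \<sigma> A D)"
    and Sym_unit: "A \<in> Obj C \<Longrightarrow> \<sigma> A \<I> = \<iota> A"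


text \<open>
  An additive structure consists of \<open>padd\<close>, relevant on parallel arrows only, and a zero arrow
  \<open>pzero A B\<close> from \<open>A\<close> to \<open>B\<close>.
\<close>

definition Hom_monoid ::
  "('o, 'a, 'x) category_scheme \<Rightarrow> ('a \<Rightarrow> 'a \<Rightarrow> 'a) \<Rightarrow> ('o \<Rightarrow> 'o \<Rightarrow> 'a) \<Rightarrow> 'o \<Rightarrow> 'o \<Rightarrow> 'a monoid"
  where "Hom_monoid C padd pzero A B =
    \<lparr>carrier = Hom C A B, monoid.mult = padd, one = pzero A B\<rparr>"

locale additive_category = category C
  for C :: "('o, 'a, 'x) category_scheme" (structure) +
  fixes padd :: "'a \<Rightarrow> 'a \<Rightarrow> 'a" and pzero :: "'o \<Rightarrow> 'o \<Rightarrow> 'a"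
  assumes Hom_comm_monoid:
      "\<lbrakk>A \<in> Obj C; B \<in> Obj C\<rbrakk> \<Longrightarrow> comm_monoid (Hom_monoid C padd pzero A B)"
    and Comp_padd: "\<lbrakk>f \<in> Hom C A B; g \<in> Hom C B D; h \<in> Hom C B D\<rbrakk>
        \<Longrightarrow> f \<Zsemi> padd g h = padd (f \<Zsemi> g) (f \<Zsemi> h)"
    and Comp_zero: "\<lbrakk>f \<in> Hom C A B; D \<in> Obj C\<rbrakk> \<Longrightarrow> f \<Zsemi> pzero B D = pzero A D"
    and plus_Comp: "\<lbrakk>g \<in> Hom C A B; h \<in> Hom C A B; k \<in> Hom C B D\<rbrakk>
        \<Longrightarrow> padd g h \<Zsemi> k = padd (g \<Zsemi> k) (h \<Zsemi> k)"
    and zero_Comp: "\<lbrakk>A \<in> Obj C; k \<in> Hom C B D\<rbrakk> \<Longrightarrow> pzero A B \<Zsemi> k = pzero A D"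

locale additive_symmetric_monoidal_category =
  strict_symmetric_monoidal_category C + additive_category C padd pzero
  for C :: "('o, 'a, 'x) smc_scheme" (structure)
    and padd :: "'a \<Rightarrow> 'a \<Rightarrow> 'a" and pzero :: "'o \<Rightarrow> 'o \<Rightarrow> 'a" +
  assumes TenA_padd: "\<lbrakk>f \<in> Hom C A B; g \<in> Hom C A' B'; h \<in> Hom C A' B'\<rbrakk>
        \<Longrightarrow> f \<boxtimes> padd g h = padd (f \<boxtimes> g) (f \<boxtimes> h)"
    and TenA_zero: "\<lbrakk>f \<in> Hom C A B; A' \<in> Obj C; B' \<in> Obj C\<rbrakk>
        \<Longrightarrow> f \<boxtimes> pzero A' B' = pzero (A \<odot> A') (B \<odot> B')"
    and plus_TenA: "\<lbrakk>g \<in> Hom C A B; h \<in> Hom C A B; k \<in> Hom C A' B'\<rbrakk>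
        \<Longrightarrow> padd g h \<boxtimes> k = padd (g \<boxtimes> k) (h \<boxtimes> k)"
    and zero_TenA: "\<lbrakk>A \<in> Obj C; B \<in> Obj C; k \<in> Hom C A' B'\<rbrakk>
        \<Longrightarrow> pzero A B \<boxtimes> k = pzero (A \<odot> A') (B \<odot> B')"

locale additive_symmetric_monoidal_category_with_negatives =
  additive_symmetric_monoidal_category C padd pzero
  for C :: "('o, 'a, 'x) smc_scheme" (structure)
    and padd :: "'a \<Rightarrow> 'a \<Rightarrow> 'a" and pzero :: "'o \<Rightarrow> 'o \<Rightarrow> 'a" +
  assumes Hom_comm_group:
      "\<lbrakk>A \<in> Obj C; B \<in> Obj C\<rbrakk> \<Longrightarrow> comm_group (Hom_monoid C padd pzero A B)"


locale comonoid_object = strict_symmetric_monoidal_category C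
  for C :: "('o, 'a, 'x) smc_scheme" (structure) +
  fixes X :: 'o and d :: 'a and c :: 'a
  assumes comonoid_Obj: "X \<in> Obj C"
    and comult_Hom: "d \<in> Hom C X (X \<odot> X)"
    and counit_Hom: "c \<in> Hom C X \<I>"
    and comult_coassoc: "d \<Zsemi> (d \<boxtimes> \<iota> X) = d \<Zsemi> (\<iota> X \<boxtimes> d)"
    and counit_left: "d \<Zsemi> (c \<boxtimes> \<iota> X) = \<iota> X"
    and counit_right: "d \<Zsemi> (\<iota> X \<boxtimes> c) = \<iota> X"

locale cocommutative_comonoid_object = comonoid_object +
  assumes cocommutative: "d \<Zsemi> \<sigma> X X = d"

locale monoid_object = strict_symmetric_monoidal_category C
  for C :: "('o, 'a, 'x) smc_scheme" (structure) +
  fixes X :: 'o and p :: 'a and v :: 'a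
  assumes monoid_Obj: "X \<in> Obj C"
    and mult_Hom: "p \<in> Hom C (X \<odot> X) X"
    and unit_Hom: "v \<in> Hom C \<I> X"
    and mult_assoc: "(p \<boxtimes> \<iota> X) \<Zsemi> p = (\<iota> X \<boxtimes> p) \<Zsemi> p"
    and unit_left: "(v \<boxtimes> \<iota> X) \<Zsemi> p = \<iota> X"
    and unit_right: "(\<iota> X \<boxtimes> v) \<Zsemi> p = \<iota> X"

locale commutative_monoid_object = monoid_object +
  assumes commutative: "\<sigma> X X \<Zsemi> p = p"

locale bimonoid_object = monoid_object C X p v + comonoid_object C X d c
  for C :: "('o, 'a, 'x) smc_scheme" (structure) and X p v d c +
  assumes mult_comult:
      "p \<Zsemi> d = (d \<boxtimes> d) \<Zsemi> (\<iota> X \<boxtimes> \<sigma> X X \<boxtimes> \<iota> X) \<Zsemi> (p \<boxtimes> p)"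
    and unit_comult: "v \<Zsemi> d = v \<boxtimes> v"
    and mult_counit: "p \<Zsemi> c = c \<boxtimes> c"
    and unit_counit: "v \<Zsemi> c = \<iota> \<I>"


text \<open>
  The endofunctors of \<open>C\<close> between which \<open>\<tau>\<close> runs are given by their object and arrow maps:
  \<open>F\<^sub>o\<close>, \<open>F\<^sub>a\<close> for the source and \<open>G\<^sub>o\<close>, \<open>G\<^sub>a\<close> for the target.
\<close>

definition natural_transformation ::
  "('o, 'a, 'x) category_scheme \<Rightarrow> ('o \<Rightarrow> 'o) \<Rightarrow> ('a \<Rightarrow> 'a) \<Rightarrow> ('o \<Rightarrow> 'o) \<Rightarrow> ('a \<Rightarrow> 'a)
    \<Rightarrow> ('o \<Rightarrow> 'a) \<Rightarrow> bool"
  where "natural_transformation C F\<^sub>o F\<^sub>a G\<^sub>o G\<^sub>a \<tau> \<longleftrightarrow>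
    (\<forall>A \<in> Obj C. \<tau> A \<in> Hom C (F\<^sub>o A) (G\<^sub>o A)) \<and>
    (\<forall>A \<in> Obj C. \<forall>B \<in> Obj C. \<forall>f \<in> Hom C A B.
      F\<^sub>a f \<Zsemi>\<^bsub>C\<^esub> \<tau> B = \<tau> A \<Zsemi>\<^bsub>C\<^esub> G\<^sub>a f)"

locale endofunctor = category C
  for C :: "('o, 'a, 'x) category_scheme" (structure) +
  fixes F\<^sub>o :: "'o \<Rightarrow> 'o" and F\<^sub>a :: "'a \<Rightarrow> 'a"
  assumes functor_Obj: "A \<in> Obj C \<Longrightarrow> F\<^sub>o A \<in> Obj C"
    and functor_Hom: "f \<in> Hom C A B \<Longrightarrow> F\<^sub>a f \<in> Hom C (F\<^sub>o A) (F\<^sub>o B)"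
    and functor_Ident: "A \<in> Obj C \<Longrightarrow> F\<^sub>a (\<iota> A) = \<iota> (F\<^sub>o A)"
    and functor_Comp:
      "\<lbrakk>f \<in> Hom C A B; g \<in> Hom C B D\<rbrakk> \<Longrightarrow> F\<^sub>a (f \<Zsemi> g) = F\<^sub>a f \<Zsemi> F\<^sub>a g"

text \<open>
  Below, the functor \<open>!\<close> has object map \<open>bang\<close> and arrow map \<open>bang\<^sub>a\<close>.
\<close>

locale comonad = endofunctor C bang bang\<^sub>a
  for C :: "('o, 'a, 'x) category_scheme" (structure) and bang bang\<^sub>a +
  fixes \<delta> \<epsilon> :: "'o \<Rightarrow> 'a"
  assumes \<delta>_natural:
      "natural_transformation C bang bang\<^sub>a (\<lambda>A. bang (bang A)) (\<lambda>f. bang\<^sub>a (bang\<^sub>a f)) \<delta>"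
    and \<epsilon>_natural: "natural_transformation C bang bang\<^sub>a (\<lambda>A. A) (\<lambda>f. f) \<epsilon>"
    and \<delta>_coassoc: "A \<in> Obj C \<Longrightarrow> \<delta> A \<Zsemi> \<delta> (bang A) = \<delta> A \<Zsemi> bang\<^sub>a (\<delta> A)"
    and \<delta>_counit_left: "A \<in> Obj C \<Longrightarrow> \<delta> A \<Zsemi> \<epsilon> (bang A) = \<iota> (bang A)"
    and \<delta>_counit_right: "A \<in> Obj C \<Longrightarrow> \<delta> A \<Zsemi> bang\<^sub>a (\<epsilon> A) = \<iota> (bang A)"

locale coalgebra_modality =
  strict_symmetric_monoidal_category C + comonad C bang bang\<^sub>a \<delta> \<epsilon>
  for C :: "('o, 'a, 'x) smc_scheme" (structure) and bang bang\<^sub>a \<delta> \<epsilon> +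
  fixes \<Delta> e :: "'o \<Rightarrow> 'a"
  assumes \<Delta>_natural: "natural_transformation C bang bang\<^sub>a
        (\<lambda>A. bang A \<odot> bang A) (\<lambda>f. bang\<^sub>a f \<boxtimes> bang\<^sub>a f) \<Delta>"
    and e_natural: "natural_transformation C bang bang\<^sub>a (\<lambda>_. \<I>) (\<lambda>_. \<iota> \<I>) e"
    and bang_comonoid:
      "A \<in> Obj C \<Longrightarrow> cocommutative_comonoid_object C (bang A) (\<Delta> A) (e A)"
    and \<delta>_\<Delta>: "A \<in> Obj C \<Longrightarrow> \<delta> A \<Zsemi> \<Delta> (bang A) = \<Delta> A \<Zsemi> (\<delta> A \<boxtimes> \<delta> A)"
    and \<delta>_e: "A \<in> Obj C \<Longrightarrow> \<delta> A \<Zsemi> e (bang A) = e A"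

locale symmetric_monoidal_endofunctor =
  strict_symmetric_monoidal_category C + endofunctor C F\<^sub>o F\<^sub>a
  for C :: "('o, 'a, 'x) smc_scheme" (structure) and F\<^sub>o F\<^sub>a +
  fixes m :: "'o \<Rightarrow> 'o \<Rightarrow> 'a" and m\<^sub>I :: 'a
  assumes m_Hom:
      "\<lbrakk>A \<in> Obj C; B \<in> Obj C\<rbrakk> \<Longrightarrow> m A B \<in> Hom C (F\<^sub>o A \<odot> F\<^sub>o B) (F\<^sub>o (A \<odot> B))"
    and m_natural: "\<lbrakk>f \<in> Hom C A B; g \<in> Hom C A' B'\<rbrakk>
        \<Longrightarrow> (F\<^sub>a f \<boxtimes> F\<^sub>a g) \<Zsemi> m B B' = m A A' \<Zsemi> F\<^sub>a (f \<boxtimes> g)"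
    and m\<^sub>I_Hom: "m\<^sub>I \<in> Hom C \<I> (F\<^sub>o \<I>)"
    and m_assoc: "\<lbrakk>A \<in> Obj C; B \<in> Obj C; D \<in> Obj C\<rbrakk>
        \<Longrightarrow> (m A B \<boxtimes> \<iota> (F\<^sub>o D)) \<Zsemi> m (A \<odot> B) D = (\<iota> (F\<^sub>o A) \<boxtimes> m B D) \<Zsemi> m A (B \<odot> D)"
    and m_unit_left: "A \<in> Obj C \<Longrightarrow> (m\<^sub>I \<boxtimes> \<iota> (F\<^sub>o A)) \<Zsemi> m \<I> A = \<iota> (F\<^sub>o A)"
    and m_unit_right: "A \<in> Obj C \<Longrightarrow> (\<iota> (F\<^sub>o A) \<boxtimes> m\<^sub>I) \<Zsemi> m A \<I> = \<iota> (F\<^sub>o A)"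
    and m_symmetry: "\<lbrakk>A \<in> Obj C; B \<in> Obj C\<rbrakk>
        \<Longrightarrow> m A B \<Zsemi> F\<^sub>a (\<sigma> A B) = \<sigma> (F\<^sub>o A) (F\<^sub>o B) \<Zsemi> m B A"

locale monoidal_coalgebra_modality =
  coalgebra_modality C bang bang\<^sub>a \<delta> \<epsilon> \<Delta> e +
  symmetric_monoidal_endofunctor C bang bang\<^sub>a m m\<^sub>I
  for C :: "('o, 'a, 'x) smc_scheme" (structure) and bang bang\<^sub>a \<delta> \<epsilon> \<Delta> e m m\<^sub>I +
  assumes m_\<delta>: "\<lbrakk>A \<in> Obj C; B \<in> Obj C\<rbrakk>
        \<Longrightarrow> m A B \<Zsemi> \<delta> (A \<odot> B) = (\<delta> A \<boxtimes> \<delta> B) \<Zsemi> m (bang A) (bang B) \<Zsemi> bang\<^sub>a (m A B)"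
    and m\<^sub>I_\<delta>: "m\<^sub>I \<Zsemi> \<delta> \<I> = m\<^sub>I \<Zsemi> bang\<^sub>a m\<^sub>I"
    and m_\<epsilon>: "\<lbrakk>A \<in> Obj C; B \<in> Obj C\<rbrakk> \<Longrightarrow> m A B \<Zsemi> \<epsilon> (A \<odot> B) = \<epsilon> A \<boxtimes> \<epsilon> B"
    and m\<^sub>I_\<epsilon>: "m\<^sub>I \<Zsemi> \<epsilon> \<I> = \<iota> \<I>"
    and m_\<Delta>: "\<lbrakk>A \<in> Obj C; B \<in> Obj C\<rbrakk>
        \<Longrightarrow> m A B \<Zsemi> \<Delta> (A \<odot> B) =
            (\<Delta> A \<boxtimes> \<Delta> B) \<Zsemi> (\<iota> (bang A) \<boxtimes> \<sigma> (bang A) (bang B) \<boxtimes> \<iota> (bang B))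
              \<Zsemi> (m A B \<boxtimes> m A B)"
    and m_e: "\<lbrakk>A \<in> Obj C; B \<in> Obj C\<rbrakk> \<Longrightarrow> m A B \<Zsemi> e (A \<odot> B) = e A \<boxtimes> e B"
    and m\<^sub>I_\<Delta>: "m\<^sub>I \<Zsemi> \<Delta> \<I> = m\<^sub>I \<boxtimes> m\<^sub>I"
    and m\<^sub>I_e: "m\<^sub>I \<Zsemi> e \<I> = \<iota> \<I>"
    and \<delta>_bang_\<Delta>: "A \<in> Obj C
        \<Longrightarrow> \<delta> A \<Zsemi> bang\<^sub>a (\<Delta> A) = \<Delta> A \<Zsemi> (\<delta> A \<boxtimes> \<delta> A) \<Zsemi> m (bang A) (bang A)"
    and \<delta>_bang_e: "A \<in> Obj C \<Longrightarrow> \<delta> A \<Zsemi> bang\<^sub>a (e A) = e A \<Zsemi> m\<^sub>I"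

locale bialgebra_modality = coalgebra_modality C bang bang\<^sub>a \<delta> \<epsilon> \<Delta> e
  for C :: "('o, 'a, 'x) smc_scheme" (structure) and bang bang\<^sub>a \<delta> \<epsilon> \<Delta> e +
  fixes nabla u :: "'o \<Rightarrow> 'a"
  assumes nabla_natural: "natural_transformation C
        (\<lambda>A. bang A \<odot> bang A) (\<lambda>f. bang\<^sub>a f \<boxtimes> bang\<^sub>a f) bang bang\<^sub>a nabla"
    and u_natural: "natural_transformation C (\<lambda>_. \<I>) (\<lambda>_. \<iota> \<I>) bang bang\<^sub>a u"
    and bang_monoid: "A \<in> Obj C \<Longrightarrow> commutative_monoid_object C (bang A) (nabla A) (u A)"
    and bang_bimonoid: "A \<in> Obj C \<Longrightarrow> bimonoid_object C (bang A) (nabla A) (u A) (\<Delta> A) (e A)"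

locale monoidal_bialgebra_modality =
  monoidal_coalgebra_modality C bang bang\<^sub>a \<delta> \<epsilon> \<Delta> e m m\<^sub>I +
  bialgebra_modality C bang bang\<^sub>a \<delta> \<epsilon> \<Delta> e nabla u
  for C :: "('o, 'a, 'x) smc_scheme" (structure) and bang bang\<^sub>a \<delta> \<epsilon> \<Delta> e m m\<^sub>I nabla u +
  assumes nabla_m_right: "\<lbrakk>A \<in> Obj C; B \<in> Obj C\<rbrakk>
        \<Longrightarrow> (\<iota> (bang A) \<boxtimes> nabla B) \<Zsemi> m A B =
            (\<Delta> A \<boxtimes> \<iota> (bang B) \<boxtimes> \<iota> (bang B))
              \<Zsemi> (\<iota> (bang A) \<boxtimes> \<sigma> (bang A) (bang B) \<boxtimes> \<iota> (bang B))
              \<Zsemi> (m A B \<boxtimes> m A B) \<Zsemi> nabla (A \<odot> B)"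
    and nabla_m_left: "\<lbrakk>A \<in> Obj C; B \<in> Obj C\<rbrakk>
        \<Longrightarrow> (nabla A \<boxtimes> \<iota> (bang B)) \<Zsemi> m A B =
            (\<iota> (bang A) \<boxtimes> \<iota> (bang A) \<boxtimes> \<Delta> B)
              \<Zsemi> (\<iota> (bang A) \<boxtimes> \<sigma> (bang A) (bang B) \<boxtimes> \<iota> (bang B))
              \<Zsemi> (m A B \<boxtimes> m A B) \<Zsemi> nabla (A \<odot> B)"
    and u_m_left: "\<lbrakk>A \<in> Obj C; B \<in> Obj C\<rbrakk>
        \<Longrightarrow> (u A \<boxtimes> \<iota> (bang B)) \<Zsemi> m A B = e B \<Zsemi> u (A \<odot> B)"
    and u_m_right: "\<lbrakk>A \<in> Obj C; B \<in> Obj C\<rbrakk>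
        \<Longrightarrow> (\<iota> (bang A) \<boxtimes> u B) \<Zsemi> m A B = e A \<Zsemi> u (A \<odot> B)"
    and nabla_\<delta>: "A \<in> Obj C
        \<Longrightarrow> nabla A \<Zsemi> \<delta> A = (\<delta> A \<boxtimes> \<delta> A) \<Zsemi> m (bang A) (bang A) \<Zsemi> bang\<^sub>a (nabla A)"
    and u_\<delta>: "A \<in> Obj C \<Longrightarrow> u A \<Zsemi> \<delta> A = m\<^sub>I \<Zsemi> bang\<^sub>a (u A)"

locale hopf_coalgebra_modality = bialgebra_modality C bang bang\<^sub>a \<delta> \<epsilon> \<Delta> e nabla u
  for C :: "('o, 'a, 'x) smc_scheme" (structure) and bang bang\<^sub>a \<delta> \<epsilon> \<Delta> e nabla u +
  fixes S :: "'o \<Rightarrow> 'a"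
  assumes S_natural: "natural_transformation C bang bang\<^sub>a bang bang\<^sub>a S"
    and antipode_right: "A \<in> Obj C \<Longrightarrow> \<Delta> A \<Zsemi> (\<iota> (bang A) \<boxtimes> S A) \<Zsemi> nabla A = e A \<Zsemi> u A"
    and antipode_left: "A \<in> Obj C \<Longrightarrow> \<Delta> A \<Zsemi> (S A \<boxtimes> \<iota> (bang A)) \<Zsemi> nabla A = e A \<Zsemi> u A"

locale monoidal_hopf_coalgebra_modality =
  monoidal_bialgebra_modality C bang bang\<^sub>a \<delta> \<epsilon> \<Delta> e m m\<^sub>I nabla u +
  hopf_coalgebra_modality C bang bang\<^sub>a \<delta> \<epsilon> \<Delta> e nabla u S
  for C :: "('o, 'a, 'x) smc_scheme" (structure) and bang bang\<^sub>a \<delta> \<epsilon> \<Delta> e m m\<^sub>I nabla u S +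
  assumes S_\<delta>: "A \<in> Obj C \<Longrightarrow> S A \<Zsemi> \<delta> A = \<delta> A \<Zsemi> bang\<^sub>a (S A)"
    and S_m_right: "\<lbrakk>A \<in> Obj C; B \<in> Obj C\<rbrakk>
        \<Longrightarrow> (\<iota> (bang A) \<boxtimes> S B) \<Zsemi> m A B = m A B \<Zsemi> S (A \<odot> B)"
    and S_m_left: "\<lbrakk>A \<in> Obj C; B \<in> Obj C\<rbrakk>
        \<Longrightarrow> (S A \<boxtimes> \<iota> (bang B)) \<Zsemi> m A B = m A B \<Zsemi> S (A \<odot> B)"

locale pre_codereliction =
  monoidal_coalgebra_modality C bang bang\<^sub>a \<delta> \<epsilon> \<Delta> e m m\<^sub>I
  for C :: "('o, 'a, 'x) smc_scheme" (structure) and bang bang\<^sub>a \<delta> \<epsilon> \<Delta> e m m\<^sub>I +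
  fixes \<eta> :: "'o \<Rightarrow> 'a"
  assumes \<eta>_natural: "natural_transformation C (\<lambda>A. A) (\<lambda>f. f) bang bang\<^sub>a \<eta>"
    and \<eta>_\<epsilon>: "A \<in> Obj C \<Longrightarrow> \<eta> A \<Zsemi> \<epsilon> A = \<iota> A"
    and \<eta>_m_left: "\<lbrakk>A \<in> Obj C; B \<in> Obj C\<rbrakk>
        \<Longrightarrow> (\<eta> A \<boxtimes> \<iota> (bang B)) \<Zsemi> m A B = (\<iota> A \<boxtimes> \<epsilon> B) \<Zsemi> \<eta> (A \<odot> B)"
    and \<eta>_m_right: "\<lbrakk>A \<in> Obj C; B \<in> Obj C\<rbrakk>
        \<Longrightarrow> (\<iota> (bang A) \<boxtimes> \<eta> B) \<Zsemi> m A B = (\<epsilon> A \<boxtimes> \<iota> B) \<Zsemi> \<eta> (A \<odot> B)"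

end

theory Submission
  imports Defs
begin

text \<open>
  The set of arrows from \<open>!A\<close> to \<open>!B\<close> is a commutative monoid under convolution
  \<open>\<Phi> * \<Psi> = \<Delta> ; (\<Phi> \<otimes> \<Psi>) ; \<nabla>\<close>, with unit \<open>e ; u\<close>, because \<open>!A\<close> is a cocommutative comonoid and \<open>!B\<close>
  a commutative monoid. The antipode makes \<open>S ; !f\<close> a convolution inverse of \<open>!f\<close>. The induced sum
  is \<open>f + g = L (!f * !g)\<close>, where \<open>L \<Phi> = \<eta> ; \<Phi> ; \<epsilon>\<close>, and likewise \<open>0 = L (e ; u)\<close> and
  \<open>-f = L (S ; !f)\<close>. Since \<open>L (!f) = f\<close>, all the group laws on homsets follow once \<open>!\<close> turns these
  operations into the convolution operations: \<open>!(f + g) = !f * !g\<close>, \<open>!0 = e ; u\<close>, \<open>!(-f) = S ; !f\<close>.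

  These three identities are instances of one principle (\<open>bang_linear_part\<close>): \<open>!(L \<Phi>) = \<Phi>\<close> as soon
  as \<open>\<Phi> : !A \<rightarrow> !B\<close> satisfies two conditions.
  The first is \<open>\<Phi> ; \<delta> = \<delta> ; !\<Phi>\<close>. By cofreeness \<open>\<Phi>\<close> is then determined by \<open>\<Phi> ; \<epsilon>\<close>, namely
  \<open>\<Phi> = \<delta> ; !(\<Phi> ; \<epsilon>)\<close>, so that it is enough to show \<open>\<Phi> ; \<epsilon> = \<epsilon> ; L \<Phi>\<close>.
  The second is compatibility with the monoidal structure, \<open>(1 \<otimes> \<Phi>) ; m = m ; \<Phi>\<close> on \<open>!I \<otimes> !A\<close>.
  It gives \<open>\<Phi> ; \<epsilon> = \<epsilon> ; L \<Phi>\<close> because the pre-codereliction rule, taken at the unit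
  object, says \<open>\<epsilon> ; \<eta> = (\<eta> \<otimes> 1) ; m\<close>: the composite \<open>\<epsilon> ; \<eta>\<close> can therefore be moved from one side
  of \<open>\<Phi>\<close> to the other. Both conditions hold for \<open>!f\<close>, \<open>e ; u\<close> and \<open>S ; !f\<close>, and convolution
  preserves them.

  Compatibility with \<open>m\<close> is treated at an arbitrary object \<open>X\<close> in place of \<open>I\<close>, as a relation
  between \<open>\<Phi> : !A \<rightarrow> !B\<close> and \<open>\<Psi> : !(X \<otimes> A) \<rightarrow> !(X \<otimes> B)\<close>; it implies
  \<open>1\<^sub>X \<otimes> L \<Phi> = L \<Psi>\<close>. As \<open>!f\<close> is related to \<open>!(1\<^sub>X \<otimes> f)\<close> and convolution respects the relation, this
  yields \<open>1\<^sub>X \<otimes> (f + g) = 1\<^sub>X \<otimes> f + 1\<^sub>X \<otimes> g\<close>, and the symmetry carries it to the left factor.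
  Distributivity of composition is naturality of all the maps involved.
\<close>

section \<open>Arrows with explicit domain and codomain\<close>

text \<open>
  Membership in a homset mentions objects that cannot be read off the arrow by unification. In
  terms of domain and codomain the typing conditions of each equation become goals that
  rewriting settles.
\<close>

context category
begin

lemma Hom_iff: "f \<in> Hom C A B \<longleftrightarrow> f \<in> Arr C \<and> Dom C f = A \<and> Cod C f = B"
  by (auto simp: Hom_def)

lemma Comp_typing [simp]:
  assumes "f \<in> Arr C" "g \<in> Arr C" "Cod C f = Dom C g"
  shows "f \<Zsemi> g \<in> Arr C" "Dom C (f \<Zsemi> g) = Dom C f" "Cod C (f \<Zsemi> g) = Cod C g"
  using Comp_Hom[of f "Dom C f" "Cod C f" g "Cod C g"] assms by (auto simp: Hom_iff)

lemma Ident_typing [simp]: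
  assumes "A \<in> Obj C"
  shows "\<iota> A \<in> Arr C" "Dom C (\<iota> A) = A" "Cod C (\<iota> A) = A"
  using Ident_Hom[OF assms] by (auto simp: Hom_iff)

lemma Dom_Cod_Obj [simp]: "f \<in> Arr C \<Longrightarrow> Dom C f \<in> Obj C" "f \<in> Arr C \<Longrightarrow> Cod C f \<in> Obj C"
  by (rule Dom_Obj Cod_Obj, assumption)+

lemma Comp_Ident [simp]:
  "\<lbrakk>f \<in> Arr C; Dom C f = A\<rbrakk> \<Longrightarrow> \<iota> A \<Zsemi> f = f"
  "\<lbrakk>f \<in> Arr C; Cod C f = B\<rbrakk> \<Longrightarrow> f \<Zsemi> \<iota> B = f"
  by (auto simp: Hom_iff intro: Ident_left Ident_right)

lemma Comp_assoc_Arr: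
  "\<lbrakk>f \<in> Arr C; g \<in> Arr C; h \<in> Arr C; Cod C f = Dom C g; Cod C g = Dom C h\<rbrakk>
    \<Longrightarrow> (f \<Zsemi> g) \<Zsemi> h = f \<Zsemi> (g \<Zsemi> h)"
  by (rule Comp_assoc) (auto simp: Hom_iff)

end

context strict_symmetric_monoidal_category
begin

declare Unit_Obj [simp] Ten_Obj [simp] Ten_assoc [simp] Ten_unit_left [simp]
  Ten_unit_right [simp] TenA_unit_left [simp] TenA_unit_right [simp]

lemma TenA_typing [simp]:
  assumes "f \<in> Arr C" "g \<in> Arr C"
  shows "f \<boxtimes> g \<in> Arr C" "Dom C (f \<boxtimes> g) = Dom C f \<odot> Dom C g"
    "Cod C (f \<boxtimes> g) = Cod C f \<odot> Cod C g"
  using TenA_Hom[of f "Dom C f" "Cod C f" g "Dom C g" "Cod C g"] assms by (auto simp: Hom_iff)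

lemma Sym_typing [simp]:
  assumes "A \<in> Obj C" "B \<in> Obj C"
  shows "\<sigma> A B \<in> Arr C" "Dom C (\<sigma> A B) = A \<odot> B" "Cod C (\<sigma> A B) = B \<odot> A"
  using Sym_Hom[OF assms] by (auto simp: Hom_iff)

lemma interchange:
  "\<lbrakk>f \<in> Arr C; g \<in> Arr C; f' \<in> Arr C; g' \<in> Arr C; Cod C f = Dom C g; Cod C f' = Dom C g'\<rbrakk>
    \<Longrightarrow> (f \<boxtimes> f') \<Zsemi> (g \<boxtimes> g') = (f \<Zsemi> g) \<boxtimes> (f' \<Zsemi> g')"
  by (rule TenA_Comp[symmetric]) (auto simp: Hom_iff)

lemma interchange_Comp:
  "\<lbrakk>f \<in> Arr C; g \<in> Arr C; f' \<in> Arr C; g' \<in> Arr C; k \<in> Arr C;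
      Cod C f = Dom C g; Cod C f' = Dom C g'; Cod C g \<odot> Cod C g' = Dom C k\<rbrakk>
    \<Longrightarrow> (f \<boxtimes> f') \<Zsemi> ((g \<boxtimes> g') \<Zsemi> k) = ((f \<Zsemi> g) \<boxtimes> (f' \<Zsemi> g')) \<Zsemi> k"
  by (simp add: Comp_assoc_Arr[symmetric] interchange)

lemma TenA_factor:
  assumes "f \<in> Hom C A B" "g \<in> Hom C A' B'"
  shows "f \<boxtimes> g = (f \<boxtimes> \<iota> A') \<Zsemi> (\<iota> B \<boxtimes> g)"
  using assms by (auto simp: Hom_iff interchange)

text \<open>Reduces statements about the left tensor factor to statements about the right one.\<close>

lemma TenA_conjugate_Sym:
  assumes f: "f \<in> Hom C A B" and k: "k \<in> Hom C A' B'"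
  shows "f \<boxtimes> k = \<sigma> A A' \<Zsemi> (k \<boxtimes> f) \<Zsemi> \<sigma> B' B"
proof -
  have typing: "f \<in> Arr C" "Dom C f = A" "Cod C f = B" "k \<in> Arr C" "Dom C k = A'" "Cod C k = B'"
      "A \<in> Obj C" "B \<in> Obj C" "A' \<in> Obj C" "B' \<in> Obj C"
    using f k by (auto simp: Hom_iff)
  have "\<sigma> A A' \<Zsemi> (k \<boxtimes> f) \<Zsemi> \<sigma> B' B = (f \<boxtimes> k) \<Zsemi> (\<sigma> B B' \<Zsemi> \<sigma> B' B)"
    using typing by (simp add: Sym_natural[OF f k, symmetric] Comp_assoc_Arr)
  then show ?thesis
    using typing by (simp add: Sym_inverse)
qed

text \<open>
  The arrow \<open>\<iota> \<boxtimes> \<sigma> \<boxtimes> \<iota>\<close> is the one in the laws relating \<open>\<Delta>\<close> and \<open>\<nabla>\<close> to \<open>m\<close>. The tensor is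
  grouped in pairs since that is the form in which copies and products of arrows meet it.
\<close>

lemma middle_swap_natural:
  assumes "f \<in> Hom C A A'" "g \<in> Hom C B B'" "h \<in> Hom C D D'" "k \<in> Hom C E E'"
  shows "((f \<boxtimes> g) \<boxtimes> (h \<boxtimes> k)) \<Zsemi> (\<iota> A' \<boxtimes> \<sigma> B' D' \<boxtimes> \<iota> E') =
    (\<iota> A \<boxtimes> \<sigma> B D \<boxtimes> \<iota> E) \<Zsemi> ((f \<boxtimes> h) \<boxtimes> (g \<boxtimes> k))"
proof -
  have regroup: "(x \<boxtimes> y) \<boxtimes> (z \<boxtimes> w) = x \<boxtimes> ((y \<boxtimes> z) \<boxtimes> w)"
    if "x \<in> Arr C" "y \<in> Arr C" "z \<in> Arr C" "w \<in> Arr C" for x y z w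
    using that by (simp add: TenA_assoc)
  have nat: "(g \<boxtimes> h) \<Zsemi> \<sigma> B' D' = \<sigma> B D \<Zsemi> (h \<boxtimes> g)"
    using assms by (auto intro: Sym_natural)
  show ?thesis
    using assms nat by (auto simp: Hom_iff regroup interchange)
qed

section \<open>The convolution monoid\<close>

definition convolution :: "'a \<Rightarrow> 'a \<Rightarrow> 'a \<Rightarrow> 'a \<Rightarrow> 'a" where
  "convolution d p f g = d \<Zsemi> (f \<boxtimes> g) \<Zsemi> p"

lemma convolution_Hom:
  assumes "comonoid_object C X d c" "monoid_object C Y p v"
    and "f \<in> Hom C X Y" "g \<in> Hom C X Y"
  shows "convolution d p f g \<in> Hom C X Y"
  using comonoid_object.comult_Hom[OF assms(1)] monoid_object.mult_Hom[OF assms(2)] assms(3,4)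
  by (auto simp: Hom_iff convolution_def)

text \<open>
  Both sides are the threefold comultiplication followed by \<open>f\<close>, \<open>g\<close>, \<open>h\<close> side by side and the
  threefold multiplication, bracketed to the left and to the right respectively.
\<close>

lemma convolution_assoc:
  assumes X: "comonoid_object C X d c" and Y: "monoid_object C Y p v"
    and f: "f \<in> Hom C X Y" and g: "g \<in> Hom C X Y" and h: "h \<in> Hom C X Y"
  shows "convolution d p (convolution d p f g) h = convolution d p f (convolution d p g h)"
proof -
  interpret X: comonoid_object C X d c by (rule X)
  interpret Y: monoid_object C Y p v by (rule Y)
  note typing = X.comult_Hom[unfolded Hom_iff] Y.mult_Hom[unfolded Hom_iff]
    f[unfolded Hom_iff] g[unfolded Hom_iff] h[unfolded Hom_iff]
    X.comonoid_Obj Y.monoid_Obj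
  have "convolution d p (convolution d p f g) h =
      (d \<Zsemi> (d \<boxtimes> \<iota> X)) \<Zsemi> ((f \<boxtimes> g) \<boxtimes> h) \<Zsemi> ((p \<boxtimes> \<iota> Y) \<Zsemi> p)"
    using typing
    by (simp add: convolution_def Comp_assoc_Arr interchange interchange_Comp)
  also have "\<dots> = (d \<Zsemi> (\<iota> X \<boxtimes> d)) \<Zsemi> (f \<boxtimes> (g \<boxtimes> h)) \<Zsemi> ((\<iota> Y \<boxtimes> p) \<Zsemi> p)"
    using typing by (simp only: X.comult_coassoc Y.mult_assoc TenA_assoc)
  also have "\<dots> = convolution d p f (convolution d p g h)"
    using typing
    by (simp add: convolution_def Comp_assoc_Arr interchange interchange_Comp)
  finally show ?thesis .
qed


lemma convolution_unit:
  assumes X: "comonoid_object C X d c" and Y: "monoid_object C Y p v" and f: "f \<in> Hom C X Y"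
  shows "convolution d p f (c \<Zsemi> v) = f"
proof -
  interpret X: comonoid_object C X d c by (rule X)
  interpret Y: monoid_object C Y p v by (rule Y)
  note typing = X.comult_Hom[unfolded Hom_iff] Y.mult_Hom[unfolded Hom_iff]
    X.counit_Hom[unfolded Hom_iff] Y.unit_Hom[unfolded Hom_iff]
    f[unfolded Hom_iff] X.comonoid_Obj Y.monoid_Obj
  have split: "f \<boxtimes> (c \<Zsemi> v) = (\<iota> X \<boxtimes> c) \<Zsemi> f \<Zsemi> (\<iota> Y \<boxtimes> v)"
  proof -
    have "(\<iota> X \<boxtimes> c) \<Zsemi> f = f \<boxtimes> c"
      using typing interchange[of "\<iota> X" f c "\<iota> \<I>"] by simp
    then show ?thesis
      using typing by (simp add: interchange)
  qed
  have "convolution d p f (c \<Zsemi> v) = (d \<Zsemi> (\<iota> X \<boxtimes> c)) \<Zsemi> f \<Zsemi> ((\<iota> Y \<boxtimes> v) \<Zsemi> p)"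
    using typing by (simp add: convolution_def split Comp_assoc_Arr)
  then show ?thesis
    using typing by (simp add: X.counit_right Y.unit_right)
qed

lemma convolution_commute:
  assumes X: "cocommutative_comonoid_object C X d c"
    and Y: "commutative_monoid_object C Y p v"
    and f: "f \<in> Hom C X Y" and g: "g \<in> Hom C X Y"
  shows "convolution d p f g = convolution d p g f"
proof -
  interpret X: cocommutative_comonoid_object C X d c by (rule X)
  interpret Y: commutative_monoid_object C Y p v by (rule Y)
  note typing = X.comult_Hom[unfolded Hom_iff] Y.mult_Hom[unfolded Hom_iff]
    f[unfolded Hom_iff] g[unfolded Hom_iff] X.comonoid_Obj Y.monoid_Obj
  have "convolution d p f g = d \<Zsemi> ((f \<boxtimes> g) \<Zsemi> \<sigma> Y Y) \<Zsemi> p"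
    using typing by (simp add: convolution_def Comp_assoc_Arr Y.commutative)
  also have "\<dots> = (d \<Zsemi> \<sigma> X X) \<Zsemi> (g \<boxtimes> f) \<Zsemi> p"
    using typing by (simp add: Sym_natural[OF f g] Comp_assoc_Arr)
  finally show ?thesis
    by (simp add: X.cocommutative convolution_def)
qed

end

section \<open>Coalgebra morphisms between cofree coalgebras\<close>

context coalgebra_modality
begin

lemma coalgebra_modality_typing [simp]:
  assumes "A \<in> Obj C"
  shows "bang A \<in> Obj C"
    "\<delta> A \<in> Arr C" "Dom C (\<delta> A) = bang A" "Cod C (\<delta> A) = bang (bang A)"
    "\<epsilon> A \<in> Arr C" "Dom C (\<epsilon> A) = bang A" "Cod C (\<epsilon> A) = A"
    "\<Delta> A \<in> Arr C" "Dom C (\<Delta> A) = bang A" "Cod C (\<Delta> A) = bang A \<odot> bang A"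
    "e A \<in> Arr C" "Dom C (e A) = bang A" "Cod C (e A) = \<I>"
  using \<delta>_natural \<epsilon>_natural \<Delta>_natural e_natural assms functor_Obj
  by (auto simp: natural_transformation_def Hom_iff)

lemma bang_typing [simp]:
  assumes "f \<in> Arr C"
  shows "bang\<^sub>a f \<in> Arr C" "Dom C (bang\<^sub>a f) = bang (Dom C f)" "Cod C (bang\<^sub>a f) = bang (Cod C f)"
  using functor_Hom[of f "Dom C f" "Cod C f"] assms by (auto simp: Hom_iff)

lemma bang_Comp:
  "\<lbrakk>f \<in> Arr C; g \<in> Arr C; Cod C f = Dom C g\<rbrakk> \<Longrightarrow> bang\<^sub>a (f \<Zsemi> g) = bang\<^sub>a f \<Zsemi> bang\<^sub>a g"
  by (rule functor_Comp) (auto simp: Hom_iff)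

lemma coalgebra_modality_natural:
  assumes "f \<in> Hom C A B"
  shows "bang\<^sub>a f \<Zsemi> \<delta> B = \<delta> A \<Zsemi> bang\<^sub>a (bang\<^sub>a f)" "bang\<^sub>a f \<Zsemi> \<epsilon> B = \<epsilon> A \<Zsemi> f"
    "bang\<^sub>a f \<Zsemi> \<Delta> B = \<Delta> A \<Zsemi> (bang\<^sub>a f \<boxtimes> bang\<^sub>a f)" "bang\<^sub>a f \<Zsemi> e B = e A"
  using \<delta>_natural \<epsilon>_natural \<Delta>_natural e_natural assms Dom_Obj Cod_Obj
  by (auto simp: natural_transformation_def Hom_iff)

text \<open>
  These are the morphisms of Eilenberg--Moore coalgebras from \<open>(!A, \<delta>)\<close> to \<open>(!B, \<delta>)\<close>, not
  morphisms of the comonoids carried by \<open>!A\<close> and \<open>!B\<close>.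
\<close>

definition coalgebra_morphism :: "'o \<Rightarrow> 'o \<Rightarrow> 'a \<Rightarrow> bool" where
  "coalgebra_morphism A B \<Phi> \<longleftrightarrow>
    \<Phi> \<in> Hom C (bang A) (bang B) \<and> \<Phi> \<Zsemi> \<delta> B = \<delta> A \<Zsemi> bang\<^sub>a \<Phi>"

lemma coalgebra_morphism_bang: "f \<in> Hom C A B \<Longrightarrow> coalgebra_morphism A B (bang\<^sub>a f)"
  by (simp add: coalgebra_morphism_def functor_Hom coalgebra_modality_natural)

text \<open>
  The uniqueness half of the universal property of the cofree coalgebra \<open>!B\<close>: insert
  \<open>\<delta> ; !\<epsilon> = 1\<close> after \<open>\<Phi>\<close> and move \<open>\<Phi>\<close> past \<open>\<delta>\<close>.
\<close>

lemma coalgebra_morphism_cofree: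
  assumes A: "A \<in> Obj C" and B: "B \<in> Obj C" and \<Phi>: "coalgebra_morphism A B \<Phi>"
  shows "\<Phi> = \<delta> A \<Zsemi> bang\<^sub>a (\<Phi> \<Zsemi> \<epsilon> B)"
proof -
  have typing: "\<Phi> \<in> Arr C" "Dom C \<Phi> = bang A" "Cod C \<Phi> = bang B"
    and coalg: "\<Phi> \<Zsemi> \<delta> B = \<delta> A \<Zsemi> bang\<^sub>a \<Phi>"
    using \<Phi> by (auto simp: coalgebra_morphism_def Hom_iff)
  have "\<Phi> = \<Phi> \<Zsemi> (\<delta> B \<Zsemi> bang\<^sub>a (\<epsilon> B))"
    using typing B by (simp add: \<delta>_counit_right)
  also have "\<dots> = (\<Phi> \<Zsemi> \<delta> B) \<Zsemi> bang\<^sub>a (\<epsilon> B)"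
    using typing B by (simp add: Comp_assoc_Arr)
  also have "\<dots> = \<delta> A \<Zsemi> bang\<^sub>a (\<Phi> \<Zsemi> \<epsilon> B)"
    using typing A B by (simp add: coalg bang_Comp Comp_assoc_Arr)
  finally show ?thesis .
qed

end

section \<open>Arrows compatible with the monoidal structure\<close>

context monoidal_coalgebra_modality
begin

lemma m_typing [simp]:
  assumes "A \<in> Obj C" "B \<in> Obj C"
  shows "m A B \<in> Arr C" "Dom C (m A B) = bang A \<odot> bang B" "Cod C (m A B) = bang (A \<odot> B)"
  using m_Hom[OF assms] by (auto simp: Hom_iff)

lemma m\<^sub>I_typing [simp]: "m\<^sub>I \<in> Arr C" "Dom C m\<^sub>I = \<I>" "Cod C m\<^sub>I = bang \<I>"
  using m\<^sub>I_Hom by (auto simp: Hom_iff)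

text \<open>
  The relation says that \<open>\<Psi>\<close> extends \<open>\<Phi>\<close> along \<open>m\<close> with parameters from \<open>!X\<close>; the model case is
  \<open>\<Phi> = !f\<close> and \<open>\<Psi> = !(1\<^sub>X \<otimes> f)\<close>. At \<open>X = I\<close>, where \<open>I \<otimes> A = A\<close>, the arrows related to themselves are
  those that commute with the action of \<open>!I\<close> on \<open>!A\<close> and \<open>!B\<close> by \<open>m\<close>.
\<close>

definition m_related :: "'o \<Rightarrow> 'o \<Rightarrow> 'o \<Rightarrow> 'a \<Rightarrow> 'a \<Rightarrow> bool" where
  "m_related X A B \<Phi> \<Psi> \<longleftrightarrow>
    \<Phi> \<in> Hom C (bang A) (bang B) \<and> \<Psi> \<in> Hom C (bang (X \<odot> A)) (bang (X \<odot> B)) \<and>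
    (\<iota> (bang X) \<boxtimes> \<Phi>) \<Zsemi> m X B = m X A \<Zsemi> \<Psi>"

lemma m_related_bang:
  assumes "X \<in> Obj C" "f \<in> Hom C A B"
  shows "m_related X A B (bang\<^sub>a f) (bang\<^sub>a (\<iota> X \<boxtimes> f))"
  using m_natural[OF Ident_Hom[OF assms(1)] assms(2)] assms
  by (auto simp: m_related_def Hom_iff functor_Ident)

lemma m_related_unit_bang: "f \<in> Hom C A B \<Longrightarrow> m_related \<I> A B (bang\<^sub>a f) (bang\<^sub>a f)"
  using m_related_bang[of \<I> f A B] by (simp add: Hom_iff)

end

context bialgebra_modality
begin

lemma bialgebra_modality_typing [simp]:
  assumes "A \<in> Obj C"
  shows "nabla A \<in> Arr C" "Dom C (nabla A) = bang A \<odot> bang A" "Cod C (nabla A) = bang A"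
    "u A \<in> Arr C" "Dom C (u A) = \<I>" "Cod C (u A) = bang A"
  using nabla_natural u_natural assms by (auto simp: natural_transformation_def Hom_iff)

lemma bialgebra_modality_natural:
  assumes "f \<in> Hom C A B"
  shows "(bang\<^sub>a f \<boxtimes> bang\<^sub>a f) \<Zsemi> nabla B = nabla A \<Zsemi> bang\<^sub>a f" "u A \<Zsemi> bang\<^sub>a f = u B"
proof -
  have "A \<in> Obj C" "B \<in> Obj C" using assms by (auto simp: Hom_iff)
  then show "(bang\<^sub>a f \<boxtimes> bang\<^sub>a f) \<Zsemi> nabla B = nabla A \<Zsemi> bang\<^sub>a f" "u A \<Zsemi> bang\<^sub>a f = u B"
    using nabla_natural u_natural assms by (auto simp: natural_transformation_def Hom_iff)
qed

abbreviation conv :: "'o \<Rightarrow> 'o \<Rightarrow> 'a \<Rightarrow> 'a \<Rightarrow> 'a" where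
  "conv A B \<equiv> convolution (\<Delta> A) (nabla B)"

lemma bang_comonoid_object: "A \<in> Obj C \<Longrightarrow> comonoid_object C (bang A) (\<Delta> A) (e A)"
  using bang_comonoid by (simp add: cocommutative_comonoid_object_def)

lemma bang_monoid_object: "A \<in> Obj C \<Longrightarrow> monoid_object C (bang A) (nabla A) (u A)"
  using bang_monoid by (simp add: commutative_monoid_object_def)

lemmas conv_Hom = convolution_Hom[OF bang_comonoid_object bang_monoid_object]
lemmas conv_assoc = convolution_assoc[OF bang_comonoid_object bang_monoid_object]
lemmas conv_unit = convolution_unit[OF bang_comonoid_object bang_monoid_object]
lemmas conv_commute = convolution_commute[OF bang_comonoid bang_monoid]

end

section \<open>Closure under convolution\<close>

context monoidal_bialgebra_modality
begin

text \<open>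
  The laws for \<open>\<nabla> ; \<delta>\<close> and \<open>\<delta> ; !\<Delta>\<close> say that \<open>\<nabla>\<close> and \<open>\<Delta>\<close> are coalgebra morphisms, when \<open>!A \<otimes> !A\<close>
  carries the coalgebra structure \<open>(\<delta> \<otimes> \<delta>) ; m\<close>; a convolution is a composite of such
  morphisms.
\<close>

lemma coalgebra_morphism_conv:
  assumes A: "A \<in> Obj C" and B: "B \<in> Obj C"
    and \<Phi>: "coalgebra_morphism A B \<Phi>" and \<Psi>: "coalgebra_morphism A B \<Psi>"
  shows "coalgebra_morphism A B (conv A B \<Phi> \<Psi>)"
proof -
  have hom: "\<Phi> \<in> Hom C (bang A) (bang B)" "\<Psi> \<in> Hom C (bang A) (bang B)"
    and coalg: "\<Phi> \<Zsemi> \<delta> B = \<delta> A \<Zsemi> bang\<^sub>a \<Phi>" "\<Psi> \<Zsemi> \<delta> B = \<delta> A \<Zsemi> bang\<^sub>a \<Psi>"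
    using \<Phi> \<Psi> by (auto simp: coalgebra_morphism_def)
  note typing = hom[unfolded Hom_iff] A B
  have "conv A B \<Phi> \<Psi> \<Zsemi> \<delta> B = \<Delta> A \<Zsemi> (\<Phi> \<boxtimes> \<Psi>) \<Zsemi> (nabla B \<Zsemi> \<delta> B)"
    using typing by (simp add: convolution_def Comp_assoc_Arr)
  also have "\<dots> = \<Delta> A \<Zsemi> ((\<Phi> \<boxtimes> \<Psi>) \<Zsemi> (\<delta> B \<boxtimes> \<delta> B)) \<Zsemi> m (bang B) (bang B) \<Zsemi> bang\<^sub>a (nabla B)"
    using typing by (simp add: nabla_\<delta> Comp_assoc_Arr)
  also have "(\<Phi> \<boxtimes> \<Psi>) \<Zsemi> (\<delta> B \<boxtimes> \<delta> B) = (\<delta> A \<boxtimes> \<delta> A) \<Zsemi> (bang\<^sub>a \<Phi> \<boxtimes> bang\<^sub>a \<Psi>)"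
    using typing by (simp add: interchange coalg)
  also have "\<Delta> A \<Zsemi> ((\<delta> A \<boxtimes> \<delta> A) \<Zsemi> (bang\<^sub>a \<Phi> \<boxtimes> bang\<^sub>a \<Psi>)) \<Zsemi> m (bang B) (bang B) \<Zsemi> bang\<^sub>a (nabla B)
      = \<Delta> A \<Zsemi> (\<delta> A \<boxtimes> \<delta> A) \<Zsemi> ((bang\<^sub>a \<Phi> \<boxtimes> bang\<^sub>a \<Psi>) \<Zsemi> m (bang B) (bang B)) \<Zsemi> bang\<^sub>a (nabla B)"
    using typing by (simp add: Comp_assoc_Arr)
  also have "\<dots> = (\<Delta> A \<Zsemi> (\<delta> A \<boxtimes> \<delta> A) \<Zsemi> m (bang A) (bang A)) \<Zsemi> bang\<^sub>a (\<Phi> \<boxtimes> \<Psi>) \<Zsemi> bang\<^sub>a (nabla B)"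
    using typing by (simp add: m_natural[OF hom] Comp_assoc_Arr)
  also have "\<Delta> A \<Zsemi> (\<delta> A \<boxtimes> \<delta> A) \<Zsemi> m (bang A) (bang A) = \<delta> A \<Zsemi> bang\<^sub>a (\<Delta> A)"
    using A by (simp add: \<delta>_bang_\<Delta>)
  also have "\<delta> A \<Zsemi> bang\<^sub>a (\<Delta> A) \<Zsemi> bang\<^sub>a (\<Phi> \<boxtimes> \<Psi>) \<Zsemi> bang\<^sub>a (nabla B) =
      \<delta> A \<Zsemi> bang\<^sub>a (conv A B \<Phi> \<Psi>)"
    using typing by (simp add: convolution_def bang_Comp Comp_assoc_Arr)
  finally show ?thesis
    using conv_Hom[OF A B hom] by (simp add: coalgebra_morphism_def)
qed

lemma coalgebra_morphism_zero:
  assumes A: "A \<in> Obj C" and B: "B \<in> Obj C"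
  shows "coalgebra_morphism A B (e A \<Zsemi> u B)"
proof -
  have "e A \<Zsemi> u B \<Zsemi> \<delta> B = (e A \<Zsemi> m\<^sub>I) \<Zsemi> bang\<^sub>a (u B)"
    using A B by (simp add: u_\<delta> Comp_assoc_Arr)
  also have "\<dots> = \<delta> A \<Zsemi> bang\<^sub>a (e A \<Zsemi> u B)"
    using A B by (simp add: \<delta>_bang_e[symmetric] bang_Comp Comp_assoc_Arr)
  finally show ?thesis
    using A B by (simp add: coalgebra_morphism_def Hom_iff)
qed

text \<open>
  Multiplying in the second argument of \<open>m\<close> duplicates the first argument, so that
  \<open>(1 \<otimes> \<nabla>) ; m\<close> turns \<open>\<Delta>\<^sub>A\<close> into \<open>\<Delta>\<^sub>X \<otimes> \<Delta>\<^sub>A\<close>. One copy of \<open>!X\<close> then meets \<open>\<Phi>\<close>, the other meets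
  \<open>\<Psi>\<close>, and each pair is handled by its hypothesis. What remains of the comultiplications is
  exactly \<open>m ; \<Delta>\<close>.
\<close>

lemma m_related_conv:
  assumes X: "X \<in> Obj C" and A: "A \<in> Obj C" and B: "B \<in> Obj C"
    and \<Phi>: "m_related X A B \<Phi> \<Phi>'" and \<Psi>: "m_related X A B \<Psi> \<Psi>'"
  shows "m_related X A B (conv A B \<Phi> \<Psi>) (conv (X \<odot> A) (X \<odot> B) \<Phi>' \<Psi>')"
proof -
  have hom: "\<Phi> \<in> Hom C (bang A) (bang B)" "\<Psi> \<in> Hom C (bang A) (bang B)"
    and hom': "\<Phi>' \<in> Hom C (bang (X \<odot> A)) (bang (X \<odot> B))"
      "\<Psi>' \<in> Hom C (bang (X \<odot> A)) (bang (X \<odot> B))"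
    and rel: "(\<iota> (bang X) \<boxtimes> \<Phi>) \<Zsemi> m X B = m X A \<Zsemi> \<Phi>'"
      "(\<iota> (bang X) \<boxtimes> \<Psi>) \<Zsemi> m X B = m X A \<Zsemi> \<Psi>'"
    using \<Phi> \<Psi> by (auto simp: m_related_def)
  note typing = hom[unfolded Hom_iff] hom'[unfolded Hom_iff] X A B
  \<comment> \<open>Naming the two middle swaps keeps rewriting from merging them with neighbouring tensors.\<close>
  define swapA where "swapA = \<iota> (bang X) \<boxtimes> \<sigma> (bang X) (bang A) \<boxtimes> \<iota> (bang A)"
  define swapB where "swapB = \<iota> (bang X) \<boxtimes> \<sigma> (bang X) (bang B) \<boxtimes> \<iota> (bang B)"
  have swap_typing: "swapA \<in> Arr C" "swapB \<in> Arr C"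
      "Dom C swapA = bang X \<odot> bang X \<odot> bang A \<odot> bang A"
      "Cod C swapA = bang X \<odot> bang A \<odot> bang X \<odot> bang A"
      "Dom C swapB = bang X \<odot> bang X \<odot> bang B \<odot> bang B"
      "Cod C swapB = bang X \<odot> bang B \<odot> bang X \<odot> bang B"
    using X A B by (simp_all add: swapA_def swapB_def)
  note typing = typing swap_typing
  have swap: "(\<iota> (bang X \<odot> bang X) \<boxtimes> (\<Phi> \<boxtimes> \<Psi>)) \<Zsemi> swapB =
      swapA \<Zsemi> ((\<iota> (bang X) \<boxtimes> \<Phi>) \<boxtimes> (\<iota> (bang X) \<boxtimes> \<Psi>))"
    using middle_swap_natural[OF Ident_Hom Ident_Hom hom, of "bang X" "bang X"] X
    by (simp add: swapA_def swapB_def TenA_Ident)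
  have nabla: "(\<iota> (bang X) \<boxtimes> nabla B) \<Zsemi> m X B =
      (\<Delta> X \<boxtimes> \<iota> (bang B \<odot> bang B)) \<Zsemi> swapB \<Zsemi> (m X B \<boxtimes> m X B) \<Zsemi> nabla (X \<odot> B)"
    using nabla_m_right[OF X B] X B by (simp add: TenA_Ident swapB_def)
  have "(\<iota> (bang X) \<boxtimes> conv A B \<Phi> \<Psi>) \<Zsemi> m X B =
      (\<iota> (bang X) \<boxtimes> (\<Delta> A \<Zsemi> (\<Phi> \<boxtimes> \<Psi>))) \<Zsemi> ((\<iota> (bang X) \<boxtimes> nabla B) \<Zsemi> m X B)"
    using typing by (simp add: convolution_def interchange_Comp)
  also have "\<dots> = ((\<iota> (bang X) \<boxtimes> (\<Delta> A \<Zsemi> (\<Phi> \<boxtimes> \<Psi>))) \<Zsemi> (\<Delta> X \<boxtimes> \<iota> (bang B \<odot> bang B)))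
      \<Zsemi> swapB \<Zsemi> (m X B \<boxtimes> m X B) \<Zsemi> nabla (X \<odot> B)"
    using typing by (simp add: nabla Comp_assoc_Arr)
  also have "(\<iota> (bang X) \<boxtimes> (\<Delta> A \<Zsemi> (\<Phi> \<boxtimes> \<Psi>))) \<Zsemi> (\<Delta> X \<boxtimes> \<iota> (bang B \<odot> bang B)) =
      (\<Delta> X \<boxtimes> \<Delta> A) \<Zsemi> (\<iota> (bang X \<odot> bang X) \<boxtimes> (\<Phi> \<boxtimes> \<Psi>))"
    using typing by (simp add: interchange)
  also have "(\<Delta> X \<boxtimes> \<Delta> A) \<Zsemi> (\<iota> (bang X \<odot> bang X) \<boxtimes> (\<Phi> \<boxtimes> \<Psi>))
        \<Zsemi> swapB \<Zsemi> (m X B \<boxtimes> m X B) \<Zsemi> nabla (X \<odot> B) =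
      (\<Delta> X \<boxtimes> \<Delta> A) \<Zsemi> ((\<iota> (bang X \<odot> bang X) \<boxtimes> (\<Phi> \<boxtimes> \<Psi>)) \<Zsemi> swapB)
        \<Zsemi> (m X B \<boxtimes> m X B) \<Zsemi> nabla (X \<odot> B)"
    using typing by (simp add: Comp_assoc_Arr)
  also have "\<dots> = (\<Delta> X \<boxtimes> \<Delta> A) \<Zsemi> swapA
      \<Zsemi> (((\<iota> (bang X) \<boxtimes> \<Phi>) \<boxtimes> (\<iota> (bang X) \<boxtimes> \<Psi>)) \<Zsemi> (m X B \<boxtimes> m X B)) \<Zsemi> nabla (X \<odot> B)"
    using typing by (simp add: swap Comp_assoc_Arr)
  also have "((\<iota> (bang X) \<boxtimes> \<Phi>) \<boxtimes> (\<iota> (bang X) \<boxtimes> \<Psi>)) \<Zsemi> (m X B \<boxtimes> m X B) =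
      (m X A \<boxtimes> m X A) \<Zsemi> (\<Phi>' \<boxtimes> \<Psi>')"
    using typing by (simp add: interchange rel)
  also have "(\<Delta> X \<boxtimes> \<Delta> A) \<Zsemi> swapA \<Zsemi> ((m X A \<boxtimes> m X A) \<Zsemi> (\<Phi>' \<boxtimes> \<Psi>')) \<Zsemi> nabla (X \<odot> B) =
      ((\<Delta> X \<boxtimes> \<Delta> A) \<Zsemi> swapA \<Zsemi> (m X A \<boxtimes> m X A)) \<Zsemi> (\<Phi>' \<boxtimes> \<Psi>') \<Zsemi> nabla (X \<odot> B)"
    using typing by (simp add: Comp_assoc_Arr)
  also have "(\<Delta> X \<boxtimes> \<Delta> A) \<Zsemi> swapA \<Zsemi> (m X A \<boxtimes> m X A) = m X A \<Zsemi> \<Delta> (X \<odot> A)"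
    using X A by (simp add: m_\<Delta> swapA_def)
  also have "m X A \<Zsemi> \<Delta> (X \<odot> A) \<Zsemi> (\<Phi>' \<boxtimes> \<Psi>') \<Zsemi> nabla (X \<odot> B) =
      m X A \<Zsemi> conv (X \<odot> A) (X \<odot> B) \<Phi>' \<Psi>'"
    using typing by (simp add: convolution_def Comp_assoc_Arr)
  finally show ?thesis
    using conv_Hom[OF A B hom] conv_Hom[OF _ _ hom'] X A B by (simp add: m_related_def)
qed

lemma m_related_zero:
  assumes X: "X \<in> Obj C" and A: "A \<in> Obj C" and B: "B \<in> Obj C"
  shows "m_related X A B (e A \<Zsemi> u B) (e (X \<odot> A) \<Zsemi> u (X \<odot> B))"
proof -
  have "(\<iota> (bang X) \<boxtimes> (e A \<Zsemi> u B)) \<Zsemi> m X B =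
      (\<iota> (bang X) \<boxtimes> e A) \<Zsemi> ((\<iota> (bang X) \<boxtimes> u B) \<Zsemi> m X B)"
    using X A B by (simp add: interchange_Comp)
  also have "\<dots> = ((\<iota> (bang X) \<boxtimes> e A) \<Zsemi> (e X \<boxtimes> \<iota> \<I>)) \<Zsemi> u (X \<odot> B)"
    using X A B by (simp add: u_m_right Comp_assoc_Arr)
  also have "(\<iota> (bang X) \<boxtimes> e A) \<Zsemi> (e X \<boxtimes> \<iota> \<I>) = m X A \<Zsemi> e (X \<odot> A)"
    using X A by (simp only: interchange m_e coalgebra_modality_typing Ident_typing
        Unit_Obj Comp_Ident)
  also have "m X A \<Zsemi> e (X \<odot> A) \<Zsemi> u (X \<odot> B) = m X A \<Zsemi> (e (X \<odot> A) \<Zsemi> u (X \<odot> B))"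
    using X A B by (simp add: Comp_assoc_Arr)
  finally show ?thesis
    using X A B by (simp add: m_related_def Hom_iff)
qed

end

section \<open>Linear parts\<close>

context pre_codereliction
begin

lemma \<eta>_typing [simp]:
  assumes "A \<in> Obj C"
  shows "\<eta> A \<in> Arr C" "Dom C (\<eta> A) = A" "Cod C (\<eta> A) = bang A"
  using \<eta>_natural assms by (auto simp: natural_transformation_def Hom_iff)

lemma \<eta>_natural_Hom: "f \<in> Hom C A B \<Longrightarrow> f \<Zsemi> \<eta> B = \<eta> A \<Zsemi> bang\<^sub>a f"
  using \<eta>_natural Dom_Obj Cod_Obj by (auto simp: natural_transformation_def Hom_iff)

definition linear_part :: "'o \<Rightarrow> 'o \<Rightarrow> 'a \<Rightarrow> 'a" where
  "linear_part A B \<Phi> = \<eta> A \<Zsemi> \<Phi> \<Zsemi> \<epsilon> B"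

lemma linear_part_Hom:
  "\<lbrakk>A \<in> Obj C; B \<in> Obj C; \<Phi> \<in> Hom C (bang A) (bang B)\<rbrakk> \<Longrightarrow> linear_part A B \<Phi> \<in> Hom C A B"
  by (auto simp: linear_part_def Hom_iff)

lemma linear_part_bang: "f \<in> Hom C A B \<Longrightarrow> linear_part A B (bang\<^sub>a f) = f"
proof -
  assume f: "f \<in> Hom C A B"
  then have typing: "f \<in> Arr C" "Dom C f = A" "Cod C f = B" "A \<in> Obj C" "B \<in> Obj C"
    by (auto simp: Hom_iff)
  have "linear_part A B (bang\<^sub>a f) = (\<eta> A \<Zsemi> \<epsilon> A) \<Zsemi> f"
    using typing by (simp add: linear_part_def coalgebra_modality_natural(2)[OF f] Comp_assoc_Arr)
  then show ?thesis
    using typing by (simp add: \<eta>_\<epsilon>)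
qed

text \<open>
  A converse to \<open>linear_part_bang\<close>: the image of \<open>!\<close> contains every arrow with the two
  properties. The pre-codereliction rule at the unit object, \<open>(\<eta> \<otimes> 1) ; m = \<epsilon> ; \<eta>\<close>, transports
  \<open>\<epsilon> ; \<eta>\<close> across \<open>\<Phi>\<close>; hence \<open>\<epsilon> ; L \<Phi> = \<epsilon> ; \<eta> ; \<Phi> ; \<epsilon> = \<Phi> ; \<epsilon> ; \<eta> ; \<epsilon> = \<Phi> ; \<epsilon>\<close>, where \<open>L \<Phi>\<close> is the linear
  part, and cofreeness does the rest.
\<close>

lemma bang_linear_part:
  assumes A: "A \<in> Obj C" and B: "B \<in> Obj C"
    and coalg: "coalgebra_morphism A B \<Phi>" and rel: "m_related \<I> A B \<Phi> \<Phi>"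
  shows "bang\<^sub>a (linear_part A B \<Phi>) = \<Phi>"
proof -
  have typing: "\<Phi> \<in> Arr C" "Dom C \<Phi> = bang A" "Cod C \<Phi> = bang B"
    using rel by (auto simp: m_related_def Hom_iff)
  have \<epsilon>\<eta>: "(\<eta> \<I> \<boxtimes> \<iota> (bang D)) \<Zsemi> m \<I> D = \<epsilon> D \<Zsemi> \<eta> D" if "D \<in> Obj C" for D
    using \<eta>_m_left[of \<I> D] that by simp
  have "\<epsilon> A \<Zsemi> linear_part A B \<Phi> = (\<epsilon> A \<Zsemi> \<eta> A) \<Zsemi> \<Phi> \<Zsemi> \<epsilon> B"
    using typing A B by (simp add: linear_part_def Comp_assoc_Arr)
  also have "\<dots> = (\<eta> \<I> \<boxtimes> \<iota> (bang A)) \<Zsemi> (m \<I> A \<Zsemi> \<Phi>) \<Zsemi> \<epsilon> B"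
    using typing A B by (simp add: \<epsilon>\<eta>[symmetric] Comp_assoc_Arr)
  also have "m \<I> A \<Zsemi> \<Phi> = (\<iota> (bang \<I>) \<boxtimes> \<Phi>) \<Zsemi> m \<I> B"
    using rel by (simp add: m_related_def)
  also have "(\<eta> \<I> \<boxtimes> \<iota> (bang A)) \<Zsemi> ((\<iota> (bang \<I>) \<boxtimes> \<Phi>) \<Zsemi> m \<I> B) \<Zsemi> \<epsilon> B =
      ((\<iota> \<I> \<boxtimes> \<Phi>) \<Zsemi> (\<eta> \<I> \<boxtimes> \<iota> (bang B))) \<Zsemi> m \<I> B \<Zsemi> \<epsilon> B"
    using typing A B
    by (simp add: interchange interchange_Comp Comp_assoc_Arr del: TenA_unit_left TenA_unit_right)
  also have "\<dots> = \<Phi> \<Zsemi> ((\<eta> \<I> \<boxtimes> \<iota> (bang B)) \<Zsemi> m \<I> B) \<Zsemi> \<epsilon> B"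
    using typing A B by (simp add: Comp_assoc_Arr)
  also have "\<dots> = \<Phi> \<Zsemi> \<epsilon> B \<Zsemi> (\<eta> B \<Zsemi> \<epsilon> B)"
    using typing A B by (simp add: \<epsilon>\<eta> Comp_assoc_Arr)
  also have "\<dots> = \<Phi> \<Zsemi> \<epsilon> B"
    using typing A B by (simp add: \<eta>_\<epsilon>)
  finally have linear: "\<epsilon> A \<Zsemi> linear_part A B \<Phi> = \<Phi> \<Zsemi> \<epsilon> B" .
  have lin: "linear_part A B \<Phi> \<in> Arr C" "Dom C (linear_part A B \<Phi>) = A"
      "Cod C (linear_part A B \<Phi>) = B"
    using typing A B by (simp_all add: linear_part_def)
  have "\<Phi> = \<delta> A \<Zsemi> bang\<^sub>a (\<epsilon> A \<Zsemi> linear_part A B \<Phi>)"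
    using coalgebra_morphism_cofree[OF A B coalg] linear by simp
  also have "\<dots> = (\<delta> A \<Zsemi> bang\<^sub>a (\<epsilon> A)) \<Zsemi> bang\<^sub>a (linear_part A B \<Phi>)"
    using lin A B by (simp add: bang_Comp Comp_assoc_Arr)
  also have "\<dots> = bang\<^sub>a (linear_part A B \<Phi>)"
    using lin A B by (simp add: \<delta>_counit_right)
  finally show ?thesis ..
qed

text \<open>
  Since \<open>m ; \<epsilon> = \<epsilon> \<otimes> \<epsilon>\<close> and \<open>(1 \<otimes> \<eta>) ; m = (\<epsilon> \<otimes> 1) ; \<eta>\<close>, the relation gives the equation after
  precomposition with \<open>\<epsilon>\<^sub>X \<otimes> 1\<close>; the section \<open>\<eta>\<^sub>X\<close> of \<open>\<epsilon>\<^sub>X\<close> cancels that factor.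
\<close>

lemma linear_part_TenA:
  assumes X: "X \<in> Obj C" and A: "A \<in> Obj C" and B: "B \<in> Obj C"
    and rel: "m_related X A B \<Phi> \<Psi>"
  shows "\<iota> X \<boxtimes> linear_part A B \<Phi> = linear_part (X \<odot> A) (X \<odot> B) \<Psi>"
proof -
  have typing: "\<Phi> \<in> Arr C" "Dom C \<Phi> = bang A" "Cod C \<Phi> = bang B"
      "\<Psi> \<in> Arr C" "Dom C \<Psi> = bang (X \<odot> A)" "Cod C \<Psi> = bang (X \<odot> B)"
    and rel_eq: "(\<iota> (bang X) \<boxtimes> \<Phi>) \<Zsemi> m X B = m X A \<Zsemi> \<Psi>"
    using rel by (auto simp: m_related_def Hom_iff)
  note typing = typing X A B
  have "\<iota> X \<boxtimes> linear_part A B \<Phi> =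
      (\<eta> X \<boxtimes> \<eta> A) \<Zsemi> (\<iota> (bang X) \<boxtimes> \<Phi>) \<Zsemi> (\<epsilon> X \<boxtimes> \<epsilon> B)"
    using typing by (simp add: linear_part_def interchange \<eta>_\<epsilon>)
  also have "\<dots> = (\<eta> X \<boxtimes> \<eta> A) \<Zsemi> ((\<iota> (bang X) \<boxtimes> \<Phi>) \<Zsemi> m X B) \<Zsemi> \<epsilon> (X \<odot> B)"
    using typing by (simp add: m_\<epsilon>[symmetric] Comp_assoc_Arr)
  also have "\<dots> = ((\<eta> X \<boxtimes> \<iota> A) \<Zsemi> (\<iota> (bang X) \<boxtimes> \<eta> A)) \<Zsemi> (m X A \<Zsemi> \<Psi>) \<Zsemi> \<epsilon> (X \<odot> B)"
    using typing by (simp add: rel_eq interchange)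
  also have "\<dots> = (\<eta> X \<boxtimes> \<iota> A) \<Zsemi> ((\<iota> (bang X) \<boxtimes> \<eta> A) \<Zsemi> m X A) \<Zsemi> \<Psi> \<Zsemi> \<epsilon> (X \<odot> B)"
    using typing by (simp add: Comp_assoc_Arr)
  also have "\<dots> = ((\<eta> X \<boxtimes> \<iota> A) \<Zsemi> (\<epsilon> X \<boxtimes> \<iota> A)) \<Zsemi> \<eta> (X \<odot> A) \<Zsemi> \<Psi> \<Zsemi> \<epsilon> (X \<odot> B)"
    using typing by (simp add: \<eta>_m_right Comp_assoc_Arr)
  also have "(\<eta> X \<boxtimes> \<iota> A) \<Zsemi> (\<epsilon> X \<boxtimes> \<iota> A) = \<iota> (X \<odot> A)"
    using typing by (simp add: interchange \<eta>_\<epsilon> TenA_Ident)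
  also have "\<iota> (X \<odot> A) \<Zsemi> \<eta> (X \<odot> A) \<Zsemi> \<Psi> \<Zsemi> \<epsilon> (X \<odot> B) = linear_part (X \<odot> A) (X \<odot> B) \<Psi>"
    using typing by (simp add: linear_part_def)
  finally show ?thesis .
qed

end


section \<open>The induced additive structure\<close>

locale induced_addition =
  monoidal_bialgebra_modality C bang bang\<^sub>a \<delta> \<epsilon> \<Delta> e m m\<^sub>I nabla u +
  pre_codereliction C bang bang\<^sub>a \<delta> \<epsilon> \<Delta> e m m\<^sub>I \<eta>
  for C :: "('o, 'a, 'x) smc_scheme" (structure)
    and bang bang\<^sub>a \<delta> \<epsilon> \<Delta> e m m\<^sub>I nabla u \<eta> +
  fixes padd :: "'a \<Rightarrow> 'a \<Rightarrow> 'a" and pzero :: "'o \<Rightarrow> 'o \<Rightarrow> 'a"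
  assumes padd_eq: "\<lbrakk>f \<in> Hom C A B; g \<in> Hom C A B\<rbrakk>
      \<Longrightarrow> padd f g = \<eta> A \<Zsemi> \<Delta> A \<Zsemi> (bang\<^sub>a f \<boxtimes> bang\<^sub>a g) \<Zsemi> nabla B \<Zsemi> \<epsilon> B"
    and pzero_eq: "\<lbrakk>A \<in> Obj C; B \<in> Obj C\<rbrakk> \<Longrightarrow> pzero A B = \<eta> A \<Zsemi> e A \<Zsemi> u B \<Zsemi> \<epsilon> B"
begin

lemma Hom_Obj: "f \<in> Hom C A B \<Longrightarrow> A \<in> Obj C" "f \<in> Hom C A B \<Longrightarrow> B \<in> Obj C"
  by (auto simp: Hom_iff)

lemma padd_linear_part:
  assumes "f \<in> Hom C A B" "g \<in> Hom C A B"
  shows "padd f g = linear_part A B (conv A B (bang\<^sub>a f) (bang\<^sub>a g))"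
  using assms Dom_Obj Cod_Obj
  by (auto simp: padd_eq linear_part_def convolution_def Comp_assoc_Arr Hom_iff)

lemma pzero_linear_part:
  assumes "A \<in> Obj C" "B \<in> Obj C"
  shows "pzero A B = linear_part A B (e A \<Zsemi> u B)"
  using assms by (simp add: pzero_eq linear_part_def Comp_assoc_Arr)

lemma padd_Hom:
  assumes "f \<in> Hom C A B" "g \<in> Hom C A B"
  shows "padd f g \<in> Hom C A B"
  unfolding padd_linear_part[OF assms] using assms
  by (intro linear_part_Hom conv_Hom functor_Hom) (auto dest: Hom_Obj)

lemma pzero_Hom: "\<lbrakk>A \<in> Obj C; B \<in> Obj C\<rbrakk> \<Longrightarrow> pzero A B \<in> Hom C A B"
  unfolding pzero_linear_part by (rule linear_part_Hom) (auto simp: Hom_iff)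

text \<open>
  The identity that makes \<open>padd\<close> inherit its laws from convolution: nested sums become nested
  convolutions.
\<close>

lemma bang_padd:
  assumes "f \<in> Hom C A B" "g \<in> Hom C A B"
  shows "bang\<^sub>a (padd f g) = conv A B (bang\<^sub>a f) (bang\<^sub>a g)"
proof -
  have Obj: "A \<in> Obj C" "B \<in> Obj C" using assms by (auto dest: Hom_Obj)
  have "m_related \<I> A B (conv A B (bang\<^sub>a f) (bang\<^sub>a g)) (conv A B (bang\<^sub>a f) (bang\<^sub>a g))"
    using m_related_conv[OF Unit_Obj Obj m_related_unit_bang m_related_unit_bang] assms Obj
    by simp
  then show ?thesis
    unfolding padd_linear_part[OF assms]
    by (intro bang_linear_part Obj coalgebra_morphism_conv coalgebra_morphism_bang assms)
qed

lemma bang_pzero: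
  assumes "A \<in> Obj C" "B \<in> Obj C"
  shows "bang\<^sub>a (pzero A B) = e A \<Zsemi> u B"
  using bang_linear_part[OF assms coalgebra_morphism_zero] m_related_zero[OF Unit_Obj assms] assms
  by (simp add: pzero_linear_part)

lemma padd_assoc:
  assumes f: "f \<in> Hom C A B" and g: "g \<in> Hom C A B" and h: "h \<in> Hom C A B"
  shows "padd (padd f g) h = padd f (padd g h)"
  using conv_assoc[OF Hom_Obj[OF f] functor_Hom[OF f] functor_Hom[OF g] functor_Hom[OF h]]
    padd_linear_part[OF padd_Hom[OF f g] h] padd_linear_part[OF f padd_Hom[OF g h]]
  by (simp add: bang_padd[OF f g] bang_padd[OF g h])

lemma padd_commute:
  assumes f: "f \<in> Hom C A B" and g: "g \<in> Hom C A B"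
  shows "padd f g = padd g f"
  using conv_commute[OF Hom_Obj[OF f] functor_Hom[OF f] functor_Hom[OF g]] assms
  by (simp add: padd_linear_part)

lemma padd_pzero:
  assumes f: "f \<in> Hom C A B"
  shows "padd f (pzero A B) = f"
  using conv_unit[OF Hom_Obj[OF f] functor_Hom[OF f]] Hom_Obj[OF f] f
  by (simp add: padd_linear_part pzero_Hom bang_pzero linear_part_bang)

lemma pzero_padd: "f \<in> Hom C A B \<Longrightarrow> padd (pzero A B) f = f"
  using padd_pzero[of f A B] padd_commute[OF pzero_Hom[OF Hom_Obj[of f A B]], of f] by simp

lemma comm_monoid_Hom:
  assumes "A \<in> Obj C" "B \<in> Obj C"
  shows "comm_monoid (Hom_monoid C padd pzero A B)"
  by (rule comm_monoidI)
    (use assms in \<open>auto simp: Hom_monoid_def padd_Hom pzero_Hom padd_assoc pzero_padd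
      intro: padd_commute\<close>)

lemma Comp_padd_left:
  assumes f: "f \<in> Hom C A B" and g: "g \<in> Hom C B D" and h: "h \<in> Hom C B D"
  shows "f \<Zsemi> padd g h = padd (f \<Zsemi> g) (f \<Zsemi> h)"
proof -
  have typing: "f \<in> Arr C" "Dom C f = A" "Cod C f = B" "g \<in> Arr C" "Dom C g = B" "Cod C g = D"
      "h \<in> Arr C" "Dom C h = B" "Cod C h = D" "A \<in> Obj C" "B \<in> Obj C" "D \<in> Obj C"
    using f g h by (auto simp: Hom_iff)
  have "f \<Zsemi> padd g h = (f \<Zsemi> \<eta> B) \<Zsemi> \<Delta> B \<Zsemi> (bang\<^sub>a g \<boxtimes> bang\<^sub>a h) \<Zsemi> nabla D \<Zsemi> \<epsilon> D"
    using typing by (simp add: padd_eq[OF g h] Comp_assoc_Arr)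
  also have "\<dots> = \<eta> A \<Zsemi> (bang\<^sub>a f \<Zsemi> \<Delta> B) \<Zsemi> (bang\<^sub>a g \<boxtimes> bang\<^sub>a h) \<Zsemi> nabla D \<Zsemi> \<epsilon> D"
    using typing by (simp add: \<eta>_natural_Hom[OF f] Comp_assoc_Arr)
  also have "\<dots> = \<eta> A \<Zsemi> \<Delta> A \<Zsemi> (bang\<^sub>a (f \<Zsemi> g) \<boxtimes> bang\<^sub>a (f \<Zsemi> h)) \<Zsemi> nabla D \<Zsemi> \<epsilon> D"
    using typing
    by (simp add: coalgebra_modality_natural[OF f] bang_Comp interchange_Comp Comp_assoc_Arr)
  finally show ?thesis
    using padd_eq[OF Comp_Hom[OF f g] Comp_Hom[OF f h]] by simp
qed

lemma Comp_pzero_left: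
  assumes f: "f \<in> Hom C A B" and D: "D \<in> Obj C"
  shows "f \<Zsemi> pzero B D = pzero A D"
proof -
  have typing: "f \<in> Arr C" "Dom C f = A" "Cod C f = B" "A \<in> Obj C" "B \<in> Obj C" "D \<in> Obj C"
    using f D by (auto simp: Hom_iff)
  have "f \<Zsemi> pzero B D = (f \<Zsemi> \<eta> B) \<Zsemi> e B \<Zsemi> u D \<Zsemi> \<epsilon> D"
    using typing by (simp add: pzero_eq Comp_assoc_Arr)
  also have "\<dots> = \<eta> A \<Zsemi> (bang\<^sub>a f \<Zsemi> e B) \<Zsemi> u D \<Zsemi> \<epsilon> D"
    using typing by (simp add: \<eta>_natural_Hom[OF f] Comp_assoc_Arr)
  finally show ?thesis
    using typing by (simp add: coalgebra_modality_natural[OF f] pzero_eq)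
qed

lemma Comp_padd_right:
  assumes g: "g \<in> Hom C A B" and h: "h \<in> Hom C A B" and k: "k \<in> Hom C B D"
  shows "padd g h \<Zsemi> k = padd (g \<Zsemi> k) (h \<Zsemi> k)"
proof -
  have typing: "k \<in> Arr C" "Dom C k = B" "Cod C k = D" "g \<in> Arr C" "Dom C g = A" "Cod C g = B"
      "h \<in> Arr C" "Dom C h = A" "Cod C h = B" "A \<in> Obj C" "B \<in> Obj C" "D \<in> Obj C"
    using g h k by (auto simp: Hom_iff)
  have "padd g h \<Zsemi> k = \<eta> A \<Zsemi> \<Delta> A \<Zsemi> (bang\<^sub>a g \<boxtimes> bang\<^sub>a h) \<Zsemi> (nabla B \<Zsemi> bang\<^sub>a k) \<Zsemi> \<epsilon> D"
    using typing
    by (simp add: padd_eq[OF g h] coalgebra_modality_natural[OF k] Comp_assoc_Arr)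
  also have "\<dots> = \<eta> A \<Zsemi> \<Delta> A \<Zsemi> (bang\<^sub>a (g \<Zsemi> k) \<boxtimes> bang\<^sub>a (h \<Zsemi> k)) \<Zsemi> nabla D \<Zsemi> \<epsilon> D"
    using typing
    by (simp add: bialgebra_modality_natural[OF k, symmetric] bang_Comp interchange_Comp
        Comp_assoc_Arr)
  finally show ?thesis
    using padd_eq[OF Comp_Hom[OF g k] Comp_Hom[OF h k]] by simp
qed

lemma Comp_pzero_right:
  assumes A: "A \<in> Obj C" and k: "k \<in> Hom C B D"
  shows "pzero A B \<Zsemi> k = pzero A D"
proof -
  have typing: "k \<in> Arr C" "Dom C k = B" "Cod C k = D" "A \<in> Obj C" "B \<in> Obj C" "D \<in> Obj C"
    using A k by (auto simp: Hom_iff)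
  have "pzero A B \<Zsemi> k = \<eta> A \<Zsemi> e A \<Zsemi> (u B \<Zsemi> bang\<^sub>a k) \<Zsemi> \<epsilon> D"
    using typing by (simp add: pzero_eq coalgebra_modality_natural[OF k] Comp_assoc_Arr)
  then show ?thesis
    using typing by (simp add: bialgebra_modality_natural[OF k] pzero_eq)
qed

lemma Ident_TenA_padd:
  assumes X: "X \<in> Obj C" and f: "f \<in> Hom C A B" and g: "g \<in> Hom C A B"
  shows "\<iota> X \<boxtimes> padd f g = padd (\<iota> X \<boxtimes> f) (\<iota> X \<boxtimes> g)"
  using linear_part_TenA[OF X Hom_Obj[OF f]
      m_related_conv[OF X Hom_Obj[OF f] m_related_bang[OF X f] m_related_bang[OF X g]]]
    padd_linear_part[OF f g]
    padd_linear_part[OF TenA_Hom[OF Ident_Hom[OF X] f] TenA_Hom[OF Ident_Hom[OF X] g]]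
  by simp

lemma Ident_TenA_pzero:
  assumes X: "X \<in> Obj C" and A: "A \<in> Obj C" and B: "B \<in> Obj C"
  shows "\<iota> X \<boxtimes> pzero A B = pzero (X \<odot> A) (X \<odot> B)"
  using linear_part_TenA[OF assms m_related_zero[OF assms]] assms
  by (simp add: pzero_linear_part)

lemma TenA_padd_right:
  assumes f: "f \<in> Hom C A B" and g: "g \<in> Hom C A' B'" and h: "h \<in> Hom C A' B'"
  shows "f \<boxtimes> padd g h = padd (f \<boxtimes> g) (f \<boxtimes> h)"
proof -
  note Obj = Hom_Obj[OF f] Hom_Obj[OF g]
  have "f \<boxtimes> padd g h = (f \<boxtimes> \<iota> A') \<Zsemi> padd (\<iota> B \<boxtimes> g) (\<iota> B \<boxtimes> h)"
    using TenA_factor[OF f padd_Hom[OF g h]] Ident_TenA_padd[OF Obj(2) g h] by simp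
  also have "\<dots> = padd ((f \<boxtimes> \<iota> A') \<Zsemi> (\<iota> B \<boxtimes> g)) ((f \<boxtimes> \<iota> A') \<Zsemi> (\<iota> B \<boxtimes> h))"
    by (rule Comp_padd_left[OF TenA_Hom[OF f Ident_Hom] TenA_Hom[OF Ident_Hom g]
          TenA_Hom[OF Ident_Hom h]]) (use Obj in auto)
  finally show ?thesis
    using TenA_factor[OF f g] TenA_factor[OF f h] by simp
qed

lemma TenA_pzero_right:
  assumes f: "f \<in> Hom C A B" and A': "A' \<in> Obj C" and B': "B' \<in> Obj C"
  shows "f \<boxtimes> pzero A' B' = pzero (A \<odot> A') (B \<odot> B')"
proof -
  note Obj = Hom_Obj[OF f]
  have "f \<boxtimes> pzero A' B' = (f \<boxtimes> \<iota> A') \<Zsemi> pzero (B \<odot> A') (B \<odot> B')"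
    using TenA_factor[OF f pzero_Hom[OF A' B']] Ident_TenA_pzero[OF Obj(2) A' B'] by simp
  also have "\<dots> = pzero (A \<odot> A') (B \<odot> B')"
    by (rule Comp_pzero_left[OF TenA_Hom[OF f Ident_Hom]]) (use Obj A' B' in auto)
  finally show ?thesis .
qed

lemma TenA_padd_left:
  assumes g: "g \<in> Hom C A B" and h: "h \<in> Hom C A B" and k: "k \<in> Hom C A' B'"
  shows "padd g h \<boxtimes> k = padd (g \<boxtimes> k) (h \<boxtimes> k)"
proof -
  note Obj = Hom_Obj[OF g] Hom_Obj[OF k]
  note swap = Sym_Hom[OF Obj(1,3)] Sym_Hom[OF Obj(4,2)]
  have "padd g h \<boxtimes> k = \<sigma> A A' \<Zsemi> padd (k \<boxtimes> g) (k \<boxtimes> h) \<Zsemi> \<sigma> B' B"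
    by (simp add: TenA_conjugate_Sym[OF padd_Hom[OF g h] k] TenA_padd_right[OF k g h])
  also have "\<dots> = padd (\<sigma> A A' \<Zsemi> (k \<boxtimes> g)) (\<sigma> A A' \<Zsemi> (k \<boxtimes> h)) \<Zsemi> \<sigma> B' B"
    by (simp add: Comp_padd_left[OF swap(1) TenA_Hom[OF k g] TenA_Hom[OF k h]])
  also have "\<dots> = padd (\<sigma> A A' \<Zsemi> (k \<boxtimes> g) \<Zsemi> \<sigma> B' B) (\<sigma> A A' \<Zsemi> (k \<boxtimes> h) \<Zsemi> \<sigma> B' B)"
    by (rule Comp_padd_right[OF Comp_Hom[OF swap(1) TenA_Hom[OF k g]]
          Comp_Hom[OF swap(1) TenA_Hom[OF k h]] swap(2)])
  finally show ?thesis
    by (simp add: TenA_conjugate_Sym[OF g k] TenA_conjugate_Sym[OF h k])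
qed

lemma TenA_pzero_left:
  assumes A: "A \<in> Obj C" and B: "B \<in> Obj C" and k: "k \<in> Hom C A' B'"
  shows "pzero A B \<boxtimes> k = pzero (A \<odot> A') (B \<odot> B')"
proof -
  note Obj = Hom_Obj[OF k]
  have "pzero A B \<boxtimes> k = \<sigma> A A' \<Zsemi> pzero (A' \<odot> A) (B' \<odot> B) \<Zsemi> \<sigma> B' B"
    by (simp add: TenA_conjugate_Sym[OF pzero_Hom[OF A B] k] TenA_pzero_right[OF k A B])
  also have "\<dots> = pzero (A \<odot> A') (B \<odot> B')"
    using Comp_pzero_left[OF Sym_Hom[OF A Obj(1)]] Comp_pzero_right[OF _ Sym_Hom[OF Obj(2) B]]
      A B Obj by simp
  finally show ?thesis .
qed

sublocale additive_symmetric_monoidal_category C padd pzero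
  by (intro additive_symmetric_monoidal_category.intro additive_category.intro
      additive_category_axioms.intro additive_symmetric_monoidal_category_axioms.intro
      strict_symmetric_monoidal_category_axioms category_axioms)
    (rule comm_monoid_Hom Comp_padd_left Comp_pzero_left Comp_padd_right Comp_pzero_right
      TenA_padd_right TenA_pzero_right TenA_padd_left TenA_pzero_left; assumption)+

end

section \<open>Negatives from the antipode\<close>

locale induced_addition_with_antipode =
  monoidal_hopf_coalgebra_modality C bang bang\<^sub>a \<delta> \<epsilon> \<Delta> e m m\<^sub>I nabla u S +
  induced_addition C bang bang\<^sub>a \<delta> \<epsilon> \<Delta> e m m\<^sub>I nabla u \<eta> padd pzero
  for C :: "('o, 'a, 'x) smc_scheme" (structure)
    and bang bang\<^sub>a \<delta> \<epsilon> \<Delta> e m m\<^sub>I nabla u S \<eta> padd pzero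
begin

lemma S_typing [simp]:
  assumes "A \<in> Obj C"
  shows "S A \<in> Arr C" "Dom C (S A) = bang A" "Cod C (S A) = bang A"
  using S_natural assms by (auto simp: natural_transformation_def Hom_iff)

definition negative :: "'o \<Rightarrow> 'o \<Rightarrow> 'a \<Rightarrow> 'a" where
  "negative A B f = \<eta> A \<Zsemi> S A \<Zsemi> bang\<^sub>a f \<Zsemi> \<epsilon> B"

lemma negative_linear_part:
  "f \<in> Hom C A B \<Longrightarrow> negative A B f = linear_part A B (S A \<Zsemi> bang\<^sub>a f)"
  using Dom_Obj Cod_Obj by (auto simp: negative_def linear_part_def Comp_assoc_Arr Hom_iff)

lemma negative_Hom: "f \<in> Hom C A B \<Longrightarrow> negative A B f \<in> Hom C A B"
  using Dom_Obj Cod_Obj by (auto simp: negative_def Hom_iff)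

text \<open>
  Since \<open>S\<close> commutes with \<open>\<delta>\<close> and with \<open>m\<close>, the arrow \<open>S ; !f\<close> has both properties required
  by \<open>bang_linear_part\<close>.
\<close>

lemma bang_negative:
  assumes f: "f \<in> Hom C A B"
  shows "bang\<^sub>a (negative A B f) = S A \<Zsemi> bang\<^sub>a f"
proof -
  have typing: "f \<in> Arr C" "Dom C f = A" "Cod C f = B" "A \<in> Obj C" "B \<in> Obj C"
    using f by (auto simp: Hom_iff)
  have "S A \<Zsemi> bang\<^sub>a f \<Zsemi> \<delta> B = (S A \<Zsemi> \<delta> A) \<Zsemi> bang\<^sub>a (bang\<^sub>a f)"
    using typing by (simp add: coalgebra_modality_natural[OF f] Comp_assoc_Arr)
  also have "\<dots> = \<delta> A \<Zsemi> bang\<^sub>a (S A \<Zsemi> bang\<^sub>a f)"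
    using typing by (simp add: S_\<delta> bang_Comp Comp_assoc_Arr)
  finally have coalg: "coalgebra_morphism A B (S A \<Zsemi> bang\<^sub>a f)"
    using typing by (simp add: coalgebra_morphism_def Hom_iff)
  have "(\<iota> (bang \<I>) \<boxtimes> (S A \<Zsemi> bang\<^sub>a f)) \<Zsemi> m \<I> B =
      (\<iota> (bang \<I>) \<boxtimes> S A) \<Zsemi> ((\<iota> (bang \<I>) \<boxtimes> bang\<^sub>a f) \<Zsemi> m \<I> B)"
    using typing by (simp add: interchange_Comp)
  also have "(\<iota> (bang \<I>) \<boxtimes> bang\<^sub>a f) \<Zsemi> m \<I> B = m \<I> A \<Zsemi> bang\<^sub>a f"
    using m_related_unit_bang[OF f] by (simp add: m_related_def)
  also have "(\<iota> (bang \<I>) \<boxtimes> S A) \<Zsemi> (m \<I> A \<Zsemi> bang\<^sub>a f) =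
      ((\<iota> (bang \<I>) \<boxtimes> S A) \<Zsemi> m \<I> A) \<Zsemi> bang\<^sub>a f"
    using typing by (simp add: Comp_assoc_Arr)
  also have "\<dots> = m \<I> A \<Zsemi> (S A \<Zsemi> bang\<^sub>a f)"
    using typing by (simp add: S_m_right Comp_assoc_Arr)
  finally have rel: "m_related \<I> A B (S A \<Zsemi> bang\<^sub>a f) (S A \<Zsemi> bang\<^sub>a f)"
    using typing by (simp add: m_related_def Hom_iff)
  show ?thesis
    using bang_linear_part[OF typing(4,5) coalg rel] by (simp add: negative_linear_part[OF f])
qed

lemma padd_negative:
  assumes f: "f \<in> Hom C A B"
  shows "padd f (negative A B f) = pzero A B"
proof -
  have typing: "f \<in> Arr C" "Dom C f = A" "Cod C f = B" "A \<in> Obj C" "B \<in> Obj C"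
    using f by (auto simp: Hom_iff)
  have "conv A B (bang\<^sub>a f) (bang\<^sub>a (negative A B f)) =
      \<Delta> A \<Zsemi> (\<iota> (bang A) \<boxtimes> S A) \<Zsemi> ((bang\<^sub>a f \<boxtimes> bang\<^sub>a f) \<Zsemi> nabla B)"
    using typing
    by (simp add: convolution_def bang_negative[OF f] interchange_Comp Comp_assoc_Arr)
  also have "\<dots> = (\<Delta> A \<Zsemi> (\<iota> (bang A) \<boxtimes> S A) \<Zsemi> nabla A) \<Zsemi> bang\<^sub>a f"
    using typing by (simp add: bialgebra_modality_natural[OF f] Comp_assoc_Arr)
  also have "\<Delta> A \<Zsemi> (\<iota> (bang A) \<boxtimes> S A) \<Zsemi> nabla A = e A \<Zsemi> u A"
    by (rule antipode_right[OF typing(4)])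
  also have "e A \<Zsemi> u A \<Zsemi> bang\<^sub>a f = e A \<Zsemi> (u A \<Zsemi> bang\<^sub>a f)"
    using typing by (simp add: Comp_assoc_Arr)
  also have "u A \<Zsemi> bang\<^sub>a f = u B"
    by (rule bialgebra_modality_natural(2)[OF f])
  finally show ?thesis
    using typing by (simp add: padd_linear_part[OF f negative_Hom[OF f]] pzero_linear_part)
qed

lemma comm_group_Hom:
  assumes "A \<in> Obj C" "B \<in> Obj C"
  shows "comm_group (Hom_monoid C padd pzero A B)"
proof -
  interpret comm_monoid "Hom_monoid C padd pzero A B" by (rule comm_monoid_Hom[OF assms])
  show ?thesis
  proof (unfold_locales, rule subsetI)
    fix f assume "f \<in> carrier (Hom_monoid C padd pzero A B)"
    then have f: "f \<in> Hom C A B" by (simp add: Hom_monoid_def)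
    have "padd (negative A B f) f = pzero A B"
      using padd_commute[OF negative_Hom[OF f] f] padd_negative[OF f] by simp
    then show "f \<in> Units (Hom_monoid C padd pzero A B)"
      using f negative_Hom[OF f] padd_negative[OF f]
      by (auto simp: Units_def Hom_monoid_def)
  qed
qed

lemma inv_eq_negative:
  assumes f: "f \<in> Hom C A B"
  shows "inv\<^bsub>Hom_monoid C padd pzero A B\<^esub> f = negative A B f"
proof -
  interpret comm_group "Hom_monoid C padd pzero A B"
    using Hom_Obj[OF f] by (rule comm_group_Hom)
  have "negative A B f \<otimes>\<^bsub>Hom_monoid C padd pzero A B\<^esub> f = \<one>\<^bsub>Hom_monoid C padd pzero A B\<^esub>"
    using padd_commute[OF negative_Hom[OF f] f] padd_negative[OF f] by (simp add: Hom_monoid_def)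
  then show ?thesis
    using inv_equality f negative_Hom[OF f] by (simp add: Hom_monoid_def)
qed

sublocale additive_symmetric_monoidal_category_with_negatives C padd pzero
  by (intro additive_symmetric_monoidal_category_with_negatives.intro
      additive_symmetric_monoidal_category_with_negatives_axioms.intro
      additive_symmetric_monoidal_category_axioms comm_group_Hom)

end

theorem proposition7p3:
  fixes C :: "('o, 'a, 'x) smc_scheme" (structure)
    and bang :: "'o \<Rightarrow> 'o" and bang\<^sub>a :: "'a \<Rightarrow> 'a"
    and \<delta> \<epsilon> \<Delta> e nabla u S \<eta> :: "'o \<Rightarrow> 'a"
    and m :: "'o \<Rightarrow> 'o \<Rightarrow> 'a" and m\<^sub>I :: 'a
    and padd :: "'a \<Rightarrow> 'a \<Rightarrow> 'a" and pzero :: "'o \<Rightarrow> 'o \<Rightarrow> 'a"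
  assumes "monoidal_hopf_coalgebra_modality C bang bang\<^sub>a \<delta> \<epsilon> \<Delta> e m m\<^sub>I nabla u S"
    and "pre_codereliction C bang bang\<^sub>a \<delta> \<epsilon> \<Delta> e m m\<^sub>I \<eta>"
    and "\<And>A B f g. \<lbrakk>f \<in> Hom C A B; g \<in> Hom C A B\<rbrakk>
          \<Longrightarrow> padd f g = \<eta> A \<Zsemi> \<Delta> A \<Zsemi> (bang\<^sub>a f \<boxtimes> bang\<^sub>a g) \<Zsemi> nabla B \<Zsemi> \<epsilon> B"
    and "\<And>A B. \<lbrakk>A \<in> Obj C; B \<in> Obj C\<rbrakk>
          \<Longrightarrow> pzero A B = \<eta> A \<Zsemi> e A \<Zsemi> u B \<Zsemi> \<epsilon> B"
  shows "additive_symmetric_monoidal_category_with_negatives C padd pzero \<and>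
    (\<forall>A \<in> Obj C. \<forall>B \<in> Obj C. \<forall>f \<in> Hom C A B.
      inv\<^bsub>Hom_monoid C padd pzero A B\<^esub> f = \<eta> A \<Zsemi> S A \<Zsemi> bang\<^sub>a f \<Zsemi> \<epsilon> B)"
proof -
  interpret H: monoidal_hopf_coalgebra_modality C bang bang\<^sub>a \<delta> \<epsilon> \<Delta> e m m\<^sub>I nabla u S
    by (rule assms(1))
  interpret P: pre_codereliction C bang bang\<^sub>a \<delta> \<epsilon> \<Delta> e m m\<^sub>I \<eta>
    by (rule assms(2))
  interpret induced_addition_with_antipode C bang bang\<^sub>a \<delta> \<epsilon> \<Delta> e m m\<^sub>I nabla u S \<eta> padd pzero
    by unfold_locales (rule assms(3,4); assumption)+
  show ?thesis
    using additive_symmetric_monoidal_category_with_negatives_axioms inv_eq_negative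
    by (simp add: negative_def)
qed

end
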